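(* Let $H_0\in\mathcal{H}$, i.e. let $H_0$ be a convex polygon in $\mathbb{R}^2$ which tessellates the plane by translations (equivalently, a centrally symmetric convex hexagon or a parallelogram). Then $H_0$ can be transformed into a regular hexagon by at most countably many Steiner symmetrizations. That is, there exists a finite or countably infinite sequence of straight lines $\pi_0,\pi_1,\pi_2,\dots$ through the origin such that, setting $H_{n+1}=S_{\pi_n}(H_n)$, either the sequence of lines is finite and the last set obtained is a regular hexagon, or it is infinite and $H_n$ converges in Hausdorff distance, as $n\to\infty$, to a regular hexagon.
   Context: $\mathcal{H}$ denotes the family of convex polygons (compact, with nonempty interior) in $\mathbb{R}^2$ which tessellate the plane by translations. It is known that such a polygon can only be either a centrally symmetric hexagon or a parallelogram. Steiner symmetrization: let $E\subset\mathbb{R}^2$ be a compact convex set with nonempty interior and let $\pi\subset\mathbb{R}^2$ be a straight line through the origin with unit normal $v$. For $x\in\pi$ set $L_x=\{x+tv : t\in\mathbb{R}\}$. The Steiner symmetrization of $E$ with respect to $\pi$ is $$S_\pi(E)=\bigcup_{x\in\pi,\ L_x\cap E\neq\emptyset}\{x+rv : 2|r|\le \mathcal{H}^1(E\cap L_x)\},$$ where $\mathcal{H}^1$ is the one-dimensional Hausdorff measure (length). The set $S_\pi(E)$ is again compact and convex with nonempty interior, and $|S_\pi(E)|=|E|$, where $|\cdot|$ is the area. *)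

theory Defs
  imports "HOL-Analysis.Analysis"
begin

definition convex_polygon :: "(real^2) set \<Rightarrow> bool" where
  "convex_polygon P \<longleftrightarrow> polytope P \<and> interior P \<noteq> {}"

text \<open>The set of translation vectors is arbitrary: it need not be a lattice, and the
  tiling need not be edge-to-edge.\<close>

definition tessellates_by_translations :: "(real^2) set \<Rightarrow> bool" where
  "tessellates_by_translations P \<longleftrightarrow>
    (\<exists>T. (\<Union>t\<in>T. (+) t ` P) = UNIV \<and>
         (\<forall>s\<in>T. \<forall>t\<in>T. s \<noteq> t \<longrightarrow> interior ((+) s ` P) \<inter> interior ((+) t ` P) = {}))"

definition tessellating_polygons :: "(real^2) set set" where
  "tessellating_polygons = {P. convex_polygon P \<and> tessellates_by_translations P}"

text \<open>One-dimensional Hausdorff measure. Covering sets are required to be bounded because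
  \<^const>\<open>diameter\<close> carries no information on unbounded sets; finite covers are included,
  as the empty set has diameter 0.\<close>

definition hausdorff_measure_1 :: "'a::metric_space set \<Rightarrow> ennreal" where
  "hausdorff_measure_1 A =
    (SUP \<delta>\<in>{0::real<..}.
      INF C\<in>{C :: nat \<Rightarrow> 'a set. A \<subseteq> (\<Union>i. C i) \<and> (\<forall>i. bounded (C i) \<and> diameter (C i) \<le> \<delta>)}.
        \<Sum>i. ennreal (diameter (C i)))"

definition line_through_origin :: "(real^2) set \<Rightarrow> bool" where
  "line_through_origin L \<longleftrightarrow> subspace L \<and> dim L = 1"

text \<open>A line has exactly two unit normals, differing by sign; the Steiner symmetrization
  below does not depend on which of them is chosen.\<close>

definition unit_normal :: "(real^2) set \<Rightarrow> real^2" where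
  "unit_normal L = (SOME v. norm v = 1 \<and> (\<forall>x\<in>L. v \<bullet> x = 0))"

definition normal_line :: "(real^2) set \<Rightarrow> real^2 \<Rightarrow> (real^2) set" where
  "normal_line L x = {x + t *\<^sub>R unit_normal L | t. True}"

definition steiner_symmetrization :: "(real^2) set \<Rightarrow> (real^2) set \<Rightarrow> (real^2) set" where
  "steiner_symmetrization L E =
    (\<Union>x\<in>{x \<in> L. normal_line L x \<inter> E \<noteq> {}}.
      {x + r *\<^sub>R unit_normal L | r. ennreal (2 * \<bar>r\<bar>) \<le> hausdorff_measure_1 (E \<inter> normal_line L x)})"

definition regular_hexagon :: "(real^2) set \<Rightarrow> bool" where
  "regular_hexagon K \<longleftrightarrow>
    (\<exists>c R \<theta>. R > 0 \<and>
      K = convex hull ((\<lambda>k::nat. c + R *\<^sub>R vector [cos (\<theta> + real k * pi / 3), sin (\<theta> + real k * pi / 3)]) ` {..<6}))"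

text \<open>Meaningful for nonempty bounded sets only, since the suprema are taken in the reals.\<close>

definition hausdorff_distance :: "'a::metric_space set \<Rightarrow> 'a set \<Rightarrow> real" where
  "hausdorff_distance A B = max (SUP x\<in>A. infdist x B) (SUP y\<in>B. infdist y A)"

end

theory Submission
  imports Defs
begin

text \<open>The proof has two parts.

\<^emph>\<open>A convex polygon that tiles the plane by translations is a centrally symmetric hexagon or a
parallelogram.\<close> Points just outside an edge are covered by other tiles, and any tile touching the
relative interior of the edge from outside touches it with the face of the opposite normal
(\<open>tile_across_edge\<close>). So an edge is covered by translates of the opposite edge, and no two of
these translates overlap. Either one translate covers the whole edge, or two translates abut inside
it (\<open>interval_cover_by_separated_translates\<close>). In the second case the polygon and its translate
along the full opposite edge are separated by a line, which confines the polygon to a strip and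
makes it a parallelogram. In both cases opposite edges have equal length, and outside the
parallelogram case the neighbour across each edge matches it exactly, which determines its translation
vector. The neighbours across two edges that meet in a vertex do not overlap each other; the line
separating them provides a third strip, beside the two strips between opposite edges, and the polygon
is the hexagon cut out by the three strips (\<open>hexagonal_if_polygon\<close>).

\<^emph>\<open>Symmetrizing along short diagonals drives a hexagon to a regular one.\<close> Let \<open>p, q, r, -p, -q, -r\<close>
be the vertices in cyclic order. The diagonals from \<open>q\<close> to \<open>-r\<close> and from \<open>r\<close> to \<open>-q\<close>
are parallel to \<open>q + r\<close>. In this direction the chord length is constant between the two diagonals
and decreases linearly to zero at \<open>p\<close> and \<open>-p\<close>, so the symmetral is again a hexagon, now with
vertices on the axis (\<open>steiner_symmetrization_hexagonal\<close>). It is determined by the half axis \<open>X\<close>,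
the half distance \<open>a\<close> of the two diagonals and the length \<open>w\<close> of the diagonals. Repeating the step
with the next short diagonal preserves \<open>(a + X) * w\<close>, sends \<open>y = w^2 / ((a + X) * w)\<close> to
\<open>1 / y + y / 4\<close>, and sends \<open>w * (X - 2 * a)\<close> to \<open>-1 / 2\<close> times itself. Hence \<open>y\<close> converges
geometrically to \<open>2 / sqrt 3\<close> and \<open>X - 2 * a\<close> converges to 0, which are the relations of a regular
hexagon. The axis turns by \<open>arctan (y / 2) - pi / 2\<close> in each step, which differs from \<open>-pi / 3\<close> by a
summable error; up to the symmetry of the regular hexagon under rotation by \<open>pi / 3\<close> its direction
converges, and so do the hexagons, whose centers tend to the origin. A parallelogram enters this
scheme as a hexagon with a straight angle at \<open>q\<close>, so the same iteration handles every tiling polygon,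
and the sequence of lines it produces is always infinite.\<close>

section \<open>Faces of a convex set in the plane\<close>

definition face :: "(real^2) set \<Rightarrow> real^2 \<Rightarrow> (real^2) set" where
  "face P n = {x \<in> P. \<forall>y\<in>P. n \<bullet> y \<le> n \<bullet> x}"

definition perp :: "real^2 \<Rightarrow> real^2" where
  "perp n = vector [- (n $ 2), n $ 1]"

lemma inner_real2: "(x::real^2) \<bullet> y = x$1 * y$1 + x$2 * y$2"
  by (simp add: inner_vec_def sum_2)

lemma perp_nth [simp]: "perp n $ 1 = - (n $ 2)" "perp n $ 2 = n $ 1"
  by (simp_all add: perp_def vector_2)

lemma inner_perp [simp]: "n \<bullet> perp n = 0" "perp n \<bullet> n = 0"
  by (simp_all add: inner_real2)

lemma perp_minus [simp]: "perp (- n) = - perp n"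
  by (simp add: vec_eq_iff forall_2)

lemma perp_eq_0_iff [simp]: "perp n = 0 \<longleftrightarrow> n = 0"
  by (auto simp: vec_eq_iff forall_2)

lemma eq_scaleR_perp_if_inner_0:
  assumes "n \<noteq> 0" "n \<bullet> x = 0"
  shows "x = ((perp n \<bullet> x) / (n \<bullet> n)) *\<^sub>R perp n"
proof -
  define D where "D = n$1 * n$1 + n$2 * n$2"
  have D: "n \<bullet> n = D" "D \<noteq> 0"
    using assms(1) inner_eq_zero_iff[of n] by (auto simp: D_def inner_real2)
  have 0: "n$1 * x$1 = - (n$2 * x$2)"
    using assms(2) by (simp add: inner_real2)
  have "x$1 * D = (- (n$2) * x$1 + n$1 * x$2) * - (n$2)"
    using 0 unfolding D_def by algebra
  moreover have "x$2 * D = (- (n$2) * x$1 + n$1 * x$2) * n$1"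
    using 0 unfolding D_def by algebra
  ultimately show ?thesis
    using D by (simp add: vec_eq_iff forall_2 inner_real2[of "perp n"] field_simps)
qed

lemma eq_0_if_inner_eq_0_both:
  fixes n :: "real^2"
  assumes "n \<noteq> 0" "n \<bullet> x = 0" "perp n \<bullet> x = 0"
  shows "x = 0"
  using eq_scaleR_perp_if_inner_0[OF assms(1,2)] assms(3) by simp

lemma compact_interval_ex:
  fixes S :: "real set"
  assumes "compact S" "convex S" "S \<noteq> {}"
  obtains lo hi where "lo \<le> hi" "S = {lo..hi}"
proof -
  have "connected S" using assms(2) convex_connected by blast
  then obtain a b where "S = {a..b}" using connected_compact_interval_1 assms(1)
    by blast
  then show thesis using that[of a b] assms(3) by auto
qed

lemma face_segment_ex:
  assumes "compact P" "convex P" "P \<noteq> {}" "n \<noteq> 0"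
  obtains a l where "l \<ge> 0" "face P n = {a + r *\<^sub>R perp n | r. 0 \<le> r \<and> r \<le> l}"
proof -
  obtain z where z: "z \<in> P" "\<forall>y\<in>P. n \<bullet> y \<le> n \<bullet> z"
    using continuous_attains_sup[of P "\<lambda>x. n \<bullet> x", OF assms(1,3)] continuous_on_inner[OF continuous_on_const continuous_on_id, of P n]
    by blast
  define S where "S = (\<lambda>r. z + r *\<^sub>R perp n) -` P"
  have "closed S" unfolding S_def
    using assms(1) by (intro closed_vimage continuous_intros compact_imp_closed)
  moreover have "bounded S"
  proof -
    obtain B where B: "\<And>x. x \<in> P \<Longrightarrow> norm x \<le> B" using assms(1) compact_imp_bounded bounded_iff by metis
    show ?thesis
    proof (rule boundedI)
      fix r assume "r \<in> S"
      then have "norm (z + r *\<^sub>R perp n) \<le> B" using B by (auto simp: S_def)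
      then have "norm (r *\<^sub>R perp n) \<le> B + norm z"
        using norm_triangle_ineq4[of "z + r *\<^sub>R perp n" z] by simp
      then show "norm r \<le> (B + norm z) / norm (perp n)"
        using assms(4) by (simp add: field_simps)
    qed
  qed
  ultimately have "compact S" by (simp add: compact_eq_bounded_closed)
  moreover have "convex S"
  proof (rule convexI)
    fix x y u v :: real assume h: "x \<in> S" "y \<in> S" "0 \<le> u" "0 \<le> v" "u + v = 1"
    have "u *\<^sub>R (z + x *\<^sub>R perp n) + v *\<^sub>R (z + y *\<^sub>R perp n) \<in> P"
      using h assms(2) by (intro convexD) (auto simp: S_def)
    also have "u *\<^sub>R (z + x *\<^sub>R perp n) + v *\<^sub>R (z + y *\<^sub>R perp n) = (u + v) *\<^sub>R z + (u * x + v * y) *\<^sub>R perp n"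
      by (simp add: algebra_simps)
    finally show "u *\<^sub>R x + v *\<^sub>R y \<in> S" using h by (simp add: S_def)
  qed
  moreover have "0 \<in> S" using z by (simp add: S_def)
  ultimately obtain lo hi where S: "lo \<le> hi" "S = {lo..hi}"
    using compact_interval_ex by (metis empty_iff)
  have "face P n = {z + r *\<^sub>R perp n | r. r \<in> S}"
  proof (intro set_eqI iffI)
    fix x assume x: "x \<in> face P n"
    then have "n \<bullet> (x - z) = 0" using z by (auto simp: face_def inner_diff_right intro: antisym)
    from eq_scaleR_perp_if_inner_0[OF assms(4) this] obtain r where "x - z = r *\<^sub>R perp n" by blast
    then have "x = z + r *\<^sub>R perp n" by (simp add: algebra_simps)
    then show "x \<in> {z + r *\<^sub>R perp n | r. r \<in> S}" using x by (auto simp: S_def face_def)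
  next
    fix x assume "x \<in> {z + r *\<^sub>R perp n | r. r \<in> S}"
    then show "x \<in> face P n" using z by (auto simp: S_def face_def inner_add_right)
  qed
  also have "\<dots> = {(z + lo *\<^sub>R perp n) + r *\<^sub>R perp n | r. 0 \<le> r \<and> r \<le> hi - lo}"
  proof (intro set_eqI iffI)
    fix x assume "x \<in> {z + r *\<^sub>R perp n | r. r \<in> S}"
    then obtain r where "x = z + r *\<^sub>R perp n" "lo \<le> r" "r \<le> hi" using S by auto
    then show "x \<in> {(z + lo *\<^sub>R perp n) + r *\<^sub>R perp n | r. 0 \<le> r \<and> r \<le> hi - lo}"
      by (intro CollectI exI[of _ "r - lo"]) (auto simp: algebra_simps)
  next
    fix x assume "x \<in> {(z + lo *\<^sub>R perp n) + r *\<^sub>R perp n | r. 0 \<le> r \<and> r \<le> hi - lo}"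
    then obtain r where "x = (z + lo *\<^sub>R perp n) + r *\<^sub>R perp n" "0 \<le> r" "r \<le> hi - lo" by auto
    then show "x \<in> {z + r *\<^sub>R perp n | r. r \<in> S}"
      using S by (intro CollectI exI[of _ "lo + r"]) (auto simp: algebra_simps)
  qed
  finally show thesis using that[of "hi - lo" "z + lo *\<^sub>R perp n"] S by simp
qed

text \<open>By finiteness, whatever covers points arbitrarily close to \<open>\<rho>\<close> from the right covers \<open>\<rho>\<close> itself.\<close>

lemma covered_right_neighbourhood:
  fixes S :: "real set"
  assumes "finite S" "\<rho> < l"
    and cov: "\<And>r. \<rho> < r \<Longrightarrow> r < l \<Longrightarrow> \<exists>\<sigma>\<in>S. \<sigma> \<le> r \<and> r \<le> \<sigma> + m"
  shows "\<exists>\<sigma>\<in>S. \<sigma> \<le> \<rho> \<and> \<rho> < \<sigma> + m"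
proof -
  \<comment> \<open>No translate begins strictly between \<open>\<rho>\<close> and \<open>Min B\<close>, so the one covering the midpoint begins before \<open>\<rho>\<close>.\<close>
  define B where "B = insert l {\<sigma>\<in>S. \<sigma> > \<rho>}"
  have B: "finite B" "B \<noteq> {}" using assms by (auto simp: B_def)
  have "Min B > \<rho>" using B assms(2) by (auto simp: B_def)
  moreover have "Min B \<le> l" using B by (auto simp: B_def)
  ultimately obtain \<sigma> where \<sigma>: "\<sigma> \<in> S" "\<sigma> \<le> (\<rho> + Min B)/2" "(\<rho> + Min B)/2 \<le> \<sigma> + m"
    using cov[of "(\<rho> + Min B)/2"] by (auto simp: field_simps)
  have "\<not> \<sigma> > \<rho>"
  proof
    assume "\<sigma> > \<rho>"
    then have "Min B \<le> \<sigma>" using B \<sigma> by (intro Min_le) (auto simp: B_def)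
    then show False using \<sigma> \<open>Min B > \<rho>\<close> by (simp add: field_simps)
  qed
  then show ?thesis using \<sigma> \<open>Min B > \<rho>\<close> by (intro bexI[of _ \<sigma>]) auto
qed

text \<open>Intervals of length \<open>m\<close> that overlap at most in end points cover \<open>{0<..<l}\<close>. If the one containing
the start of the interval does not reach \<open>l\<close>, the next one must begin exactly where it ends.\<close>

lemma interval_cover_by_separated_translates:
  fixes S :: "real set"
  assumes fin: "finite S" and l: "0 < l"
    and cov: "\<And>r. 0 < r \<Longrightarrow> r < l \<Longrightarrow> \<exists>\<sigma>\<in>S. \<sigma> \<le> r \<and> r \<le> \<sigma> + m"
    and sep: "\<And>\<sigma> \<tau>. \<sigma> \<in> S \<Longrightarrow> \<tau> \<in> S \<Longrightarrow> \<sigma> \<noteq> \<tau> \<Longrightarrow> m \<le> \<bar>\<tau> - \<sigma>\<bar>"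
  shows "(\<exists>\<sigma>\<in>S. \<sigma> \<le> 0 \<and> l \<le> \<sigma> + m) \<or> (\<exists>\<sigma>\<in>S. \<exists>\<tau>\<in>S. \<tau> = \<sigma> + m \<and> 0 < m)"
proof -
  obtain \<sigma> where \<sigma>: "\<sigma> \<in> S" "\<sigma> \<le> 0" "0 < \<sigma> + m"
    using covered_right_neighbourhood[OF fin l cov] by auto
  show ?thesis
  proof (cases "l \<le> \<sigma> + m")
    case False
    then obtain \<tau> where \<tau>: "\<tau> \<in> S" "\<tau> \<le> \<sigma> + m" "\<sigma> + m < \<tau> + m"
      using covered_right_neighbourhood[OF fin, of "\<sigma> + m" l m] cov \<sigma> by auto
    then have "m \<le> \<bar>\<tau> - \<sigma>\<bar>" using sep[of \<sigma> \<tau>] \<sigma> by auto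
    then show ?thesis using \<tau> \<sigma> by (intro disjI2 bexI[of _ \<sigma>] bexI[of _ \<tau>]) auto
  qed (use \<sigma> in auto)
qed

section \<open>Edges in a tiling by translates\<close>

text \<open>Disjointness of interiors is encoded by a line separating the tiles \<open>P + s\<close> and \<open>P + t\<close>, since all
later arguments look at the direction of this line. The assumption \<open>0 \<in> T\<close> makes \<open>P\<close> one of the
tiles.\<close>

locale translative_tiling =
  fixes P T :: "(real^2) set"
  assumes cpt: "compact P" and cvx: "convex P" and int: "interior P \<noteq> {}"
    and zero: "0 \<in> T"
    and cover: "\<And>z. \<exists>t\<in>T. z - t \<in> P"
    and separated: "\<And>s t. s \<in> T \<Longrightarrow> t \<in> T \<Longrightarrow> s \<noteq> t \<Longrightarrow>
      \<exists>f. f \<noteq> 0 \<and> (\<forall>x\<in>P. \<forall>y\<in>P. f \<bullet> (x - y) \<le> f \<bullet> (t - s))"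
begin

lemma nonempty: "P \<noteq> {}"
  using int interior_subset by auto

lemma width_lower_bound:
  obtains d where "d > 0" "\<And>f. \<exists>x\<in>P. \<exists>y\<in>P. f \<bullet> (x - y) \<ge> d * norm f"
proof -
  obtain c e where ce: "e > 0" "cball c e \<subseteq> P"
    using int mem_interior_cball by (metis ex_in_conv)
  show thesis
  proof (rule that[of e])
    show "e > 0" by fact
    fix f :: "real^2"
    have "c + (e / norm f) *\<^sub>R f \<in> P" "c \<in> P"
      using ce(1) by (auto simp: dist_norm intro!: subsetD[OF ce(2)])
    moreover have "e * norm f \<le> f \<bullet> (c + (e / norm f) *\<^sub>R f - c)"
      by (simp add: dot_square_norm power2_eq_square)
    ultimately show "\<exists>x\<in>P. \<exists>y\<in>P. f \<bullet> (x - y) \<ge> e * norm f" by blast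
  qed
qed

lemma width_pos:
  assumes "f \<noteq> 0" obtains x y where "x \<in> P" "y \<in> P" "f \<bullet> y < f \<bullet> x"
proof -
  obtain d where d: "d > 0" "\<And>f. \<exists>x\<in>P. \<exists>y\<in>P. f \<bullet> (x - y) \<ge> d * norm f"
    using width_lower_bound by blast
  obtain x y where xy: "x \<in> P" "y \<in> P" "f \<bullet> (x - y) \<ge> d * norm f" using d(2) by blast
  have "d * norm f > 0" using d(1) assms by simp
  with xy show thesis by (intro that[of x y]) (auto simp: inner_diff_right)
qed

text \<open>A line separating two tiles makes their translation vectors differ by at least the width of \<open>P\<close> in
the normal direction, which is bounded below because \<open>P\<close> contains a disc.\<close>

lemma finite_bounded_translations:
  assumes "bounded B" shows "finite (T \<inter> B)"
proof (rule ccontr)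
  assume inf: "infinite (T \<inter> B)"
  obtain d where d: "d > 0" "\<And>f. \<exists>x\<in>P. \<exists>y\<in>P. f \<bullet> (x - y) \<ge> d * norm f"
    using width_lower_bound by blast
  have far: "d \<le> dist s t" if st: "s \<in> T" "t \<in> T" "s \<noteq> t" for s t
  proof -
    obtain f where f: "f \<noteq> 0" "\<forall>x\<in>P. \<forall>y\<in>P. f \<bullet> (x - y) \<le> f \<bullet> (t - s)"
      using separated[OF st] by blast
    obtain x y where "x \<in> P" "y \<in> P" "f \<bullet> (x - y) \<ge> d * norm f" using d(2) by blast
    then have "d * norm f \<le> f \<bullet> (t - s)" using f(2) by force
    also have "\<dots> \<le> norm f * norm (t - s)" by (rule norm_cauchy_schwarz)
    finally show ?thesis using f(1) by (simp add: dist_norm norm_minus_commute)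
  qed
  have "closed (T \<inter> B)"
    using far d(1) by (intro discrete_imp_closed[of d]) (auto simp: dist_norm not_less[symmetric])
  then have "compact (T \<inter> B)" using assms by (simp add: compact_eq_bounded_closed bounded_Int)
  then obtain x where x: "x \<in> T \<inter> B" "x islimpt (T \<inter> B)"
    using inf unfolding compact_eq_Bolzano_Weierstrass by blast
  then obtain y where "y \<in> T" "y \<noteq> x" "dist y x < d"
    using d(1) unfolding islimpt_approachable by blast
  then show False using far[of y x] x by auto
qed

text \<open>The points \<open>z + \<delta> n\<close> just outside the edge at its relative interior point \<open>z\<close> lie in other tiles. Only
finitely many tiles come near \<open>z\<close>, so one of these contains \<open>z\<close>. A line separating it from \<open>P\<close> passes
through \<open>z\<close> and supports \<open>P\<close>, hence contains the edge; so the tile lies beyond the line of the edge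
and meets it in its own face with normal \<open>-n\<close>.\<close>

lemma tile_across_edge:
  assumes n: "n \<noteq> 0"
    and F: "face P n = {a + r *\<^sub>R perp n | r. 0 \<le> r \<and> r \<le> l}"
    and r: "0 < r" "r < l"
  obtains t where "t \<in> T" "a + r *\<^sub>R perp n - t \<in> face P (- n)"
proof -
  define z where "z = a + r *\<^sub>R perp n"
  have zF: "z \<in> face P n" using r by (auto simp: F z_def)
  then have zP: "z \<in> P" and zmax: "\<And>y. y \<in> P \<Longrightarrow> n \<bullet> y \<le> n \<bullet> z" by (auto simp: face_def)
  obtain M where M: "\<And>x. x \<in> P \<Longrightarrow> norm x \<le> M"
    using cpt compact_imp_bounded bounded_iff by metis
  define T0 where "T0 = T \<inter> cball 0 (norm z + norm n + M)"
  have fin: "finite T0" unfolding T0_def by (rule finite_bounded_translations) simp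
  \<comment> \<open>The nearby tiles that miss \<open>z\<close> form a closed set, so \<open>\<delta>\<close> can be chosen to avoid all of them.\<close>
  define C where "C = (\<Union>t\<in>{t\<in>T0. z - t \<notin> P}. (+) t ` P)"
  have "closed C" unfolding C_def using fin cpt
    by (intro closed_UN) (auto intro: compact_imp_closed closed_translation)
  moreover have "z \<notin> C" unfolding C_def by auto
  ultimately obtain e where e: "e > 0" "ball z e \<subseteq> - C"
    unfolding closed_def open_contains_ball by (metis ComplI)
  define \<delta> where "\<delta> = min 1 (e / (2 * norm n))"
  have \<delta>: "\<delta> > 0" "\<delta> \<le> 1" "\<delta> * norm n < e"
    using e(1) n by (auto simp: \<delta>_def min_def field_simps)
  have notC: "z + \<delta> *\<^sub>R n \<notin> C"
    using e(2) \<delta> by (auto simp: subset_iff dist_norm)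
  obtain t where t: "t \<in> T" "z + \<delta> *\<^sub>R n - t \<in> P" using cover by blast
  have "norm t \<le> norm z + norm n + M"
  proof -
    have "t = z + \<delta> *\<^sub>R n - (z + \<delta> *\<^sub>R n - t)" by simp
    then have "norm t \<le> norm (z + \<delta> *\<^sub>R n) + norm (z + \<delta> *\<^sub>R n - t)"
      by (metis norm_triangle_ineq4)
    also have "norm (z + \<delta> *\<^sub>R n) \<le> norm z + \<delta> * norm n"
      using norm_triangle_ineq[of z "\<delta> *\<^sub>R n"] \<delta> by simp
    also have "\<delta> * norm n \<le> norm n" using \<delta> by (simp add: mult_left_le_one_le)
    finally show ?thesis using M[OF t(2)] by simp
  qed
  then have "t \<in> T0" using t by (simp add: T0_def)
  have ztP: "z - t \<in> P"
  proof (rule ccontr)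
    assume "z - t \<notin> P"
    moreover have "z + \<delta> *\<^sub>R n \<in> (+) t ` P"
      using t(2) by (intro image_eqI[of _ _ "z + \<delta> *\<^sub>R n - t"]) auto
    ultimately show False using notC \<open>t \<in> T0\<close> unfolding C_def by blast
  qed
  have "t \<noteq> 0"
  proof
    assume "t = 0"
    then have "n \<bullet> (z + \<delta> *\<^sub>R n) \<le> n \<bullet> z" using t zmax by simp
    then have "\<delta> * (n \<bullet> n) \<le> 0" by (simp add: inner_add_right)
    moreover have "n \<bullet> n > 0" using n by simp
    ultimately show False using \<delta>(1) by (simp add: mult_le_0_iff)
  qed
  then obtain f where f: "f \<noteq> 0" "\<forall>x\<in>P. \<forall>y\<in>P. f \<bullet> (x - y) \<le> f \<bullet> t"
    using separated[OF zero t(1)] by auto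
  have fz: "f \<bullet> x \<le> f \<bullet> z" if "x \<in> P" for x
    using f(2)[rule_format, OF that ztP] by (simp add: inner_diff_right)
  have fzt: "f \<bullet> (z - t) \<le> f \<bullet> y" if "y \<in> P" for y
    using f(2)[rule_format, OF zP that] by (simp add: inner_diff_right)
  \<comment> \<open>\<open>f\<close> is maximal on \<open>P\<close> at \<open>z\<close>, which is interior to the edge, so it is constant along the edge.\<close>
  have "f \<bullet> perp n = 0"
  proof (rule antisym)
    have 1: "a + l *\<^sub>R perp n \<in> P" "a + 0 *\<^sub>R perp n \<in> P" using F r by (force simp: face_def)+
    show "f \<bullet> perp n \<le> 0"
    proof -
      have "(l - r) * (f \<bullet> perp n) \<le> 0"
        using fz[OF 1(1)] by (simp add: z_def inner_add_right algebra_simps)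
      then show ?thesis using r by (simp add: mult_le_0_iff)
    qed
    show "0 \<le> f \<bullet> perp n"
      using fz[OF 1(2)] r by (simp add: z_def inner_add_right zero_le_mult_iff)
  qed
  then have "perp n \<bullet> f = 0" by (simp add: inner_commute)
  from eq_scaleR_perp_if_inner_0[OF _ this] n obtain \<mu>' where "f = \<mu>' *\<^sub>R perp (perp n)" by auto
  moreover have "perp (perp n) = - n" by (simp add: vec_eq_iff forall_2)
  ultimately have \<mu>: "f = (- \<mu>') *\<^sub>R n" by simp
  define \<mu> where "\<mu> = - \<mu>'"
  have f\<mu>: "f = \<mu> *\<^sub>R n" using \<mu> by (simp add: \<mu>_def)
  obtain x y where xy: "x \<in> P" "y \<in> P" "n \<bullet> y < n \<bullet> x" using width_pos[OF n] by blast
  have "n \<bullet> y < n \<bullet> z" using xy zmax[of x] by simp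
  moreover have "\<mu> * (n \<bullet> y) \<le> \<mu> * (n \<bullet> z)" using fz[OF xy(2)] by (simp add: f\<mu>)
  ultimately have "\<mu> \<ge> 0" by (smt (verit) mult_less_cancel_left)
  then have "\<mu> > 0" using f(1) f\<mu> by (cases "\<mu> = 0") auto
  then have "n \<bullet> (z - t) \<le> n \<bullet> y" if "y \<in> P" for y
    using fzt[OF that] by (simp add: f\<mu>)
  then have "z - t \<in> face P (- n)" using ztP by (simp add: face_def)
  then show thesis using that t(1) z_def by blast
qed

end

lemma segment_reverse:
  fixes p :: "'a::real_vector"
  shows "{b + r *\<^sub>R p | r. 0 \<le> r \<and> r \<le> l} = {(b + l *\<^sub>R p) + r *\<^sub>R (- p) | r. 0 \<le> r \<and> r \<le> l}"
proof (intro set_eqI iffI)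
  fix x assume "x \<in> {b + r *\<^sub>R p | r. 0 \<le> r \<and> r \<le> l}"
  then obtain r where "x = b + r *\<^sub>R p" "0 \<le> r" "r \<le> l" by blast
  then show "x \<in> {(b + l *\<^sub>R p) + r *\<^sub>R (- p) | r. 0 \<le> r \<and> r \<le> l}"
    by (intro CollectI exI[of _ "l - r"]) (auto simp: algebra_simps)
next
  fix x assume "x \<in> {(b + l *\<^sub>R p) + r *\<^sub>R (- p) | r. 0 \<le> r \<and> r \<le> l}"
  then obtain r where "x = (b + l *\<^sub>R p) + r *\<^sub>R (- p)" "0 \<le> r" "r \<le> l" by blast
  then show "x \<in> {b + r *\<^sub>R p | r. 0 \<le> r \<and> r \<le> l}"
    by (intro CollectI exI[of _ "l - r"]) (auto simp: algebra_simps)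
qed

context translative_tiling
begin

text \<open>The edge with normal \<open>n\<close> is covered by translates of the face with normal \<open>-n\<close>. If a single translate
covers it, the claim on the lengths is clear. Otherwise two translates abut, so \<open>P\<close> and its translate
by the whole opposite edge are separated; the separating functional attains its extrema over \<open>P\<close> at
the two ends of the opposite edge, and no parallel edge can be longer than that.\<close>

lemma edge_covered_by_opposite_translates:
  assumes n: "n \<noteq> 0"
    and F: "face P n = {a + r *\<^sub>R perp n | r. 0 \<le> r \<and> r \<le> l}"
    and F': "face P (- n) = {b + r *\<^sub>R perp n | r. 0 \<le> r \<and> r \<le> l'}"
    and l: "0 < l" and l': "0 \<le> l'"
  shows "l \<le> l' \<and> ((\<exists>\<sigma>\<le>0. l \<le> \<sigma> + l' \<and> (a - b) + \<sigma> *\<^sub>R perp n \<in> T) \<or>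
    (\<exists>f. f \<noteq> 0 \<and> (\<forall>x\<in>P. f \<bullet> b \<le> f \<bullet> x \<and> f \<bullet> x \<le> f \<bullet> (b + l' *\<^sub>R perp n))))"
proof -
  \<comment> \<open>Positions, along the line of the edge, of the opposite faces of the tiles that can reach the edge.\<close>
  define S where "S = {\<sigma>. (a - b) + \<sigma> *\<^sub>R perp n \<in> T \<and> - l' \<le> \<sigma> \<and> \<sigma> \<le> l}"
  have aP: "a \<in> P" "a + l *\<^sub>R perp n \<in> P" and bP: "b \<in> P" "b + l' *\<^sub>R perp n \<in> P"
    using F F' l l' by (force simp: face_def)+
  have "finite S"
  proof -
    have "finite (T \<inter> (\<lambda>\<sigma>. (a - b) + \<sigma> *\<^sub>R perp n) ` {-l'..l})"
      by (intro finite_bounded_translations compact_imp_bounded compact_continuous_image continuous_intros) simp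
    moreover have "(\<lambda>\<sigma>. (a - b) + \<sigma> *\<^sub>R perp n) ` S \<subseteq> (T \<inter> (\<lambda>\<sigma>. (a - b) + \<sigma> *\<^sub>R perp n) ` {-l'..l})"
      by (auto simp: S_def)
    ultimately have "finite ((\<lambda>\<sigma>. (a - b) + \<sigma> *\<^sub>R perp n) ` S)" by (rule rev_finite_subset)
    moreover have "inj_on (\<lambda>\<sigma>. (a - b) + \<sigma> *\<^sub>R perp n) S" using n by (auto simp: inj_on_def)
    ultimately show ?thesis using finite_imageD by blast
  qed
  moreover have "\<exists>\<sigma>\<in>S. \<sigma> \<le> r \<and> r \<le> \<sigma> + l'" if r: "0 < r" "r < l" for r
  proof -
    obtain t where t: "t \<in> T" "a + r *\<^sub>R perp n - t \<in> face P (- n)"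
      using tile_across_edge[OF n F r] by blast
    then obtain r' where r': "0 \<le> r'" "r' \<le> l'" "a + r *\<^sub>R perp n - t = b + r' *\<^sub>R perp n"
      by (auto simp: F')
    then have "t = (a - b) + (r - r') *\<^sub>R perp n" by (simp add: algebra_simps)
    then have "r - r' \<in> S" using t(1) r r' by (auto simp: S_def)
    then show ?thesis using r' by (intro bexI[of _ "r - r'"]) auto
  qed
  moreover have sepS: "\<exists>f. f \<noteq> 0 \<and> f \<bullet> perp n \<noteq> 0 \<and> (\<forall>x\<in>P. \<forall>y\<in>P. f \<bullet> (x - y) \<le> (\<tau> - \<sigma>) * (f \<bullet> perp n))"
    if st: "\<sigma> \<in> S" "\<tau> \<in> S" "\<sigma> \<noteq> \<tau>" for \<sigma> \<tau>
  proof -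
    have "(a - b) + \<sigma> *\<^sub>R perp n \<noteq> (a - b) + \<tau> *\<^sub>R perp n" using st n by simp
    then obtain f where f: "f \<noteq> 0"
      "\<forall>x\<in>P. \<forall>y\<in>P. f \<bullet> (x - y) \<le> f \<bullet> (((a - b) + \<tau> *\<^sub>R perp n) - ((a - b) + \<sigma> *\<^sub>R perp n))"
      using separated st unfolding S_def by blast
    have eq: "f \<bullet> (((a - b) + \<tau> *\<^sub>R perp n) - ((a - b) + \<sigma> *\<^sub>R perp n)) = (\<tau> - \<sigma>) * (f \<bullet> perp n)"
      by (simp add: inner_diff_right inner_add_right algebra_simps)
    obtain x y where xy: "x \<in> P" "y \<in> P" "f \<bullet> y < f \<bullet> x" using width_pos[OF f(1)] by blast
    then have "0 < (\<tau> - \<sigma>) * (f \<bullet> perp n)" using f(2) eq by (fastforce simp: inner_diff_right)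
    then have "f \<bullet> perp n \<noteq> 0" by auto
    then show ?thesis using f eq by auto
  qed
  moreover have "l' \<le> \<bar>\<tau> - \<sigma>\<bar>" if st: "\<sigma> \<in> S" "\<tau> \<in> S" "\<sigma> \<noteq> \<tau>" for \<sigma> \<tau>
  proof -
    obtain f where f: "f \<bullet> perp n \<noteq> 0" "\<forall>x\<in>P. \<forall>y\<in>P. f \<bullet> (x - y) \<le> (\<tau> - \<sigma>) * (f \<bullet> perp n)"
      using sepS[OF st] by blast
    have 1: "l' * (f \<bullet> perp n) \<le> (\<tau> - \<sigma>) * (f \<bullet> perp n)"
      using f(2)[rule_format, OF bP(2) bP(1)] by simp
    have 2: "- l' * (f \<bullet> perp n) \<le> (\<tau> - \<sigma>) * (f \<bullet> perp n)"
      using f(2)[rule_format, OF bP(1) bP(2)] by simp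
    have "l' * \<bar>f \<bullet> perp n\<bar> \<le> (\<tau> - \<sigma>) * (f \<bullet> perp n)" using 1 2 by (auto simp: abs_if)
    also have "\<dots> \<le> \<bar>\<tau> - \<sigma>\<bar> * \<bar>f \<bullet> perp n\<bar>" by (metis abs_ge_self abs_mult)
    finally show ?thesis using f(1) by simp
  qed
  ultimately consider (single) \<sigma> where "\<sigma> \<in> S" "\<sigma> \<le> 0" "l \<le> \<sigma> + l'"
    | (double) \<sigma> \<tau> where "\<sigma> \<in> S" "\<tau> \<in> S" "\<tau> = \<sigma> + l'" "0 < l'"
    using interval_cover_by_separated_translates[of S l l'] l by blast
  then show ?thesis
  proof cases
    case single
    then show ?thesis by (auto simp: S_def)
  next
    case double
    then obtain f where f: "f \<noteq> 0" "f \<bullet> perp n \<noteq> 0" "\<forall>x\<in>P. \<forall>y\<in>P. f \<bullet> (x - y) \<le> l' * (f \<bullet> perp n)"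
      using sepS[of \<sigma> \<tau>] by auto
    have "0 \<le> l' * (f \<bullet> perp n)" using f(3)[rule_format, OF bP(1) bP(1)] by simp
    then have pos: "0 < f \<bullet> perp n" using f(2) double(4) by (auto simp: zero_le_mult_iff)
    have "f \<bullet> b \<le> f \<bullet> x \<and> f \<bullet> x \<le> f \<bullet> (b + l' *\<^sub>R perp n)" if "x \<in> P" for x
      using f(3)[rule_format, OF that bP(1)] f(3)[rule_format, OF bP(2) that]
      by (simp add: inner_diff_right inner_add_right)
    moreover have "l \<le> l'"
      using f(3)[rule_format, OF aP(2) aP(1)] pos by simp
    ultimately show ?thesis using f(1) by blast
  qed
qed

text \<open>Applying the inequality between the lengths to \<open>n\<close> and to \<open>-n\<close> makes opposite edges equally long. A
single covering translate must then match the edge exactly, so the neighbouring tile is \<open>P + (a - b)\<close>.\<close>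

lemma opposite_edges:
  assumes n: "n \<noteq> 0"
    and F: "face P n = {a + r *\<^sub>R perp n | r. 0 \<le> r \<and> r \<le> l}"
    and l: "0 < l"
  obtains b where "face P (- n) = {b + r *\<^sub>R perp n | r. 0 \<le> r \<and> r \<le> l}"
    "a - b \<in> T \<or> (\<exists>f. f \<noteq> 0 \<and> (\<forall>x\<in>P. f \<bullet> b \<le> f \<bullet> x \<and> f \<bullet> x \<le> f \<bullet> (b + l *\<^sub>R perp n)))"
proof -
  have "- n \<noteq> 0" using n by simp
  obtain b' l' where l': "l' \<ge> 0" and "face P (- n) = {b' + r *\<^sub>R perp (- n) | r. 0 \<le> r \<and> r \<le> l'}"
    by (rule face_segment_ex[OF cpt cvx nonempty \<open>- n \<noteq> 0\<close>])
  then have F': "face P (- n) = {(b' - l' *\<^sub>R perp n) + r *\<^sub>R perp n | r. 0 \<le> r \<and> r \<le> l'}"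
    using segment_reverse[of b' "- perp n" l'] by simp
  define b where "b = b' - l' *\<^sub>R perp n"
  note F' = F'[folded b_def]
  note 1 = edge_covered_by_opposite_translates[OF n F F' l l']
  then have "l \<le> l'" by simp
  moreover have "l' \<le> l"
  proof -
    have "face P (- n) = {(b + l' *\<^sub>R perp n) + r *\<^sub>R perp (- n) | r. 0 \<le> r \<and> r \<le> l'}"
      "face P (- (- n)) = {(a + l *\<^sub>R perp n) + r *\<^sub>R perp (- n) | r. 0 \<le> r \<and> r \<le> l}"
      using F' F segment_reverse[of b "perp n" l'] segment_reverse[of a "perp n" l] by simp_all
    from edge_covered_by_opposite_translates[OF _ this] show ?thesis
      using n l 1 by auto
  qed
  ultimately have [simp]: "l' = l" by simp
  have "\<sigma> = 0" if "\<sigma> \<le> 0" "l \<le> \<sigma> + l" for \<sigma> using that by simp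
  then have "a - b \<in> T \<or> (\<exists>f. f \<noteq> 0 \<and> (\<forall>x\<in>P. f \<bullet> b \<le> f \<bullet> x \<and> f \<bullet> x \<le> f \<bullet> (b + l *\<^sub>R perp n)))"
    using 1 by auto
  then show thesis using that F' by auto
qed

end

section \<open>Tiling polygons are centrally symmetric hexagons\<close>

text \<open>The hexagon with center \<open>c\<close> and consecutive vertices \<open>p, q, r, -p, -q, -r\<close> relative to \<open>c\<close>. The
functionals \<open>\<alpha>\<close>, \<open>\<beta>\<close>, \<open>\<gamma>\<close> cut out the strips between the three pairs of opposite sides
\<open>pq\<close>, \<open>qr\<close> and \<open>r(-p)\<close>. A straight angle at \<open>q\<close> or at \<open>r\<close> is allowed, so that parallelograms are
included. The strict inequalities say that \<open>p\<close> is not collinear with \<open>q\<close> and \<open>-r\<close>; together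
with \<open>q \<noteq> r\<close> they are what symmetrization along \<open>q + r\<close> needs in order to yield a genuine hexagon.\<close>

definition hexagonal :: "(real^2) set \<Rightarrow> real^2 \<Rightarrow> real^2 \<Rightarrow> real^2 \<Rightarrow> real^2 \<Rightarrow> bool" where
  "hexagonal E c p q r \<longleftrightarrow> convex E \<and> q \<noteq> r \<and> {c + p, c - p, c + q, c - q, c + r, c - r} \<subseteq> E \<and>
    (\<exists>\<alpha> \<beta> \<gamma>. (\<forall>x\<in>E. \<bar>\<alpha> \<bullet> (x - c)\<bar> \<le> 1 \<and> \<bar>\<beta> \<bullet> (x - c)\<bar> \<le> 1 \<and> \<bar>\<gamma> \<bullet> (x - c)\<bar> \<le> 1) \<and>
      \<alpha> \<bullet> p = 1 \<and> \<alpha> \<bullet> q = 1 \<and> \<beta> \<bullet> q = 1 \<and> \<beta> \<bullet> r = 1 \<and> \<gamma> \<bullet> r = 1 \<and> \<gamma> \<bullet> p = -1 \<and>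
      \<alpha> \<bullet> r > -1 \<and> \<gamma> \<bullet> q > -1)"

text \<open>Since \<open>y\<close> and its reflection \<open>2 c - y\<close> in \<open>c\<close> lie on the two boundary lines, the strip is symmetric
about \<open>c\<close>.\<close>

lemma normalise_strip:
  fixes f :: "'a::real_inner"
  assumes strip: "\<forall>x\<in>P. f \<bullet> (2 *\<^sub>R c - y) \<le> f \<bullet> x \<and> f \<bullet> x \<le> f \<bullet> y"
    and w: "\<exists>x\<in>P. \<exists>x'\<in>P. f \<bullet> x < f \<bullet> x'"
  defines "k \<equiv> f \<bullet> (y - c)"
  shows "k > 0" "\<forall>x\<in>P. \<bar>(f /\<^sub>R k) \<bullet> (x - c)\<bar> \<le> 1"
proof -
  have s: "- k \<le> f \<bullet> (x - c)" "f \<bullet> (x - c) \<le> k" if "x \<in> P" for x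
    using strip that by (auto simp: k_def inner_diff_right)
  obtain x x' where "x \<in> P" "x' \<in> P" "f \<bullet> x < f \<bullet> x'" using w by blast
  then show "k > 0" using s[of x] s[of x'] by (simp add: inner_diff_right)
  show "\<forall>x\<in>P. \<bar>(f /\<^sub>R k) \<bullet> (x - c)\<bar> \<le> 1"
  proof
    fix x assume "x \<in> P"
    then have "\<bar>f \<bullet> (x - c)\<bar> \<le> k" using s[of x] by linarith
    then show "\<bar>(f /\<^sub>R k) \<bullet> (x - c)\<bar> \<le> 1"
      using \<open>k > 0\<close> by (simp add: abs_mult field_simps)
  qed
qed

text \<open>The supporting line with normal \<open>n\<close> is turned about \<open>z\<close> towards the normal \<open>d\<close> until it hits
another vertex. The number \<open>\<kappa>\<close> is the steepest slope, as seen from \<open>z\<close>, of a vertex below that line.\<close>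

lemma next_supporting_line:
  fixes P :: "'a::real_inner set"
  assumes P: "P = convex hull V" "finite V"
    and z: "z \<in> P" "\<And>x. x \<in> P \<Longrightarrow> n \<bullet> x \<le> n \<bullet> z"
    and lower: "x0 \<in> P" "n \<bullet> x0 < n \<bullet> z"
    and d: "\<And>x. x \<in> P \<Longrightarrow> n \<bullet> x = n \<bullet> z \<Longrightarrow> d \<bullet> x \<le> d \<bullet> z"
  obtains v \<kappa> where "v \<in> P" "n \<bullet> v < n \<bullet> z" "(d + \<kappa> *\<^sub>R n) \<bullet> v = (d + \<kappa> *\<^sub>R n) \<bullet> z"
    "\<forall>x\<in>P. (d + \<kappa> *\<^sub>R n) \<bullet> x \<le> (d + \<kappa> *\<^sub>R n) \<bullet> z"
proof -
  define W where "W = {v \<in> V. n \<bullet> v < n \<bullet> z}"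
  have VP: "v \<in> P" if "v \<in> V" for v using that P hull_inc by metis
  have "W \<noteq> {}"
  proof
    assume "W = {}"
    then have "V \<subseteq> {x. n \<bullet> x \<ge> n \<bullet> z}" by (auto simp: W_def not_less)
    then have "P \<subseteq> {x. n \<bullet> x \<ge> n \<bullet> z}" unfolding P
      by (intro hull_minimal convex_halfspace_ge)
    then show False using lower by auto
  qed
  define g where "g v = (d \<bullet> v - d \<bullet> z) / (n \<bullet> z - n \<bullet> v)" for v
  define \<kappa> where "\<kappa> = Max (g ` W)"
  have fin: "finite (g ` W)" "g ` W \<noteq> {}" using P \<open>W \<noteq> {}\<close> by (auto simp: W_def)
  obtain v where v: "v \<in> W" "\<kappa> = g v" using Max_in[OF fin] by (auto simp: \<kappa>_def)
  have "(d + \<kappa> *\<^sub>R n) \<bullet> x \<le> (d + \<kappa> *\<^sub>R n) \<bullet> z" if "x \<in> V" for x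
  proof (cases "x \<in> W")
    case True
    then have "g x \<le> \<kappa>" using Max_ge[OF fin(1)] by (auto simp: \<kappa>_def)
    then have "d \<bullet> x - d \<bullet> z \<le> \<kappa> * (n \<bullet> z - n \<bullet> x)"
      using True by (simp add: g_def W_def pos_divide_le_eq)
    then show ?thesis by (simp add: inner_add_left right_diff_distrib)
  next
    case False
    then have "n \<bullet> x = n \<bullet> z" using z(2)[OF VP[OF that]] that by (auto simp: W_def)
    then show ?thesis using d[OF VP[OF that]] by (simp add: inner_add_left)
  qed
  then have "V \<subseteq> {x. (d + \<kappa> *\<^sub>R n) \<bullet> x \<le> (d + \<kappa> *\<^sub>R n) \<bullet> z}" by auto
  then have "P \<subseteq> {x. (d + \<kappa> *\<^sub>R n) \<bullet> x \<le> (d + \<kappa> *\<^sub>R n) \<bullet> z}" unfolding P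
    by (intro hull_minimal convex_halfspace_le)
  moreover have "(d + \<kappa> *\<^sub>R n) \<bullet> v = (d + \<kappa> *\<^sub>R n) \<bullet> z"
    using v by (simp add: g_def W_def inner_add_left field_simps)
  ultimately show thesis using v VP by (intro that[of v \<kappa>]) (auto simp: W_def)
qed

lemma segment_ends:
  fixes p :: "'a::real_vector"
  assumes "0 \<le> l"
  shows "a \<in> {a + r *\<^sub>R p | r. 0 \<le> r \<and> r \<le> l}" "a + l *\<^sub>R p \<in> {a + r *\<^sub>R p | r. 0 \<le> r \<and> r \<le> l}"
  using assms by (force intro: exI[of _ "0::real"] exI[of _ l])+

context translative_tiling
begin

lemma width_pos_ex:
  assumes "f \<noteq> 0" shows "\<exists>x\<in>P. \<exists>x'\<in>P. f \<bullet> x < f \<bullet> x'"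
proof -
  obtain x y where "x \<in> P" "y \<in> P" "f \<bullet> y < f \<bullet> x" by (rule width_pos[OF assms])
  then show ?thesis by blast
qed

lemma edge_if_two_points:
  assumes "n \<noteq> 0" "x \<in> face P n" "y \<in> face P n" "x \<noteq> y"
  obtains a l where "l > 0" "face P n = {a + r *\<^sub>R perp n | r. 0 \<le> r \<and> r \<le> l}"
proof -
  obtain a l where al: "l \<ge> 0" "face P n = {a + r *\<^sub>R perp n | r. 0 \<le> r \<and> r \<le> l}"
    by (rule face_segment_ex[OF cpt cvx nonempty assms(1)])
  moreover have "l \<noteq> 0" using al assms by auto
  ultimately show thesis using that[of l a] by simp
qed

lemma opposite_face_two_points:
  assumes "n \<noteq> 0" "x \<in> face P n" "y \<in> face P n" "x \<noteq> y"
  obtains x' y' where "x' \<in> face P (- n)" "y' \<in> face P (- n)" "x' \<noteq> y'"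
proof -
  obtain a l where al: "l > 0" "face P n = {a + r *\<^sub>R perp n | r. 0 \<le> r \<and> r \<le> l}"
    by (rule edge_if_two_points[OF assms])
  obtain b where b: "face P (- n) = {b + r *\<^sub>R perp n | r. 0 \<le> r \<and> r \<le> l}"
    by (rule opposite_edges[OF assms(1) al(2,1)])
  show thesis
  proof (rule that[of "b + 0 *\<^sub>R perp n" "b + l *\<^sub>R perp n"])
    show "b + 0 *\<^sub>R perp n \<in> face P (- n)" unfolding b using al(1)
      by (intro CollectI exI[of _ "0::real"]) auto
    show "b + l *\<^sub>R perp n \<in> face P (- n)" unfolding b using al(1)
      by (intro CollectI exI[of _ l]) auto
    show "b + 0 *\<^sub>R perp n \<noteq> b + l *\<^sub>R perp n" using al(1) assms(1) by simp
  qed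
qed

text \<open>In this case \<open>P\<close> is a parallelogram. The middle of the side from \<open>a\<close> to \<open>a + l *\<^sub>R perp n\<close> serves as
the vertex \<open>q\<close> with a straight angle.\<close>

lemma hexagonal_if_parallelogram:
  assumes n: "n \<noteq> 0" and l: "l > 0"
    and a: "a \<in> face P n" "a + l *\<^sub>R perp n \<in> face P n"
    and b: "b \<in> face P (- n)" "b + l *\<^sub>R perp n \<in> face P (- n)"
    and f: "f \<noteq> 0" "\<forall>x\<in>P. f \<bullet> b \<le> f \<bullet> x \<and> f \<bullet> x \<le> f \<bullet> (b + l *\<^sub>R perp n)"
  shows "\<exists>c p q r. hexagonal P c p q r"
proof -
  define e where "e = l *\<^sub>R perp n"
  define c where "c = (1/2) *\<^sub>R (a + b + e)"
  have c2: "2 *\<^sub>R c = a + b + e" by (simp add: c_def)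
  have P: "a \<in> P" "a + e \<in> P" "b \<in> P" "b + e \<in> P" using a b by (auto simp: face_def e_def)
  have fab: "f \<bullet> a = f \<bullet> b"
    using f(2)[rule_format, OF P(1)] f(2)[rule_format, OF P(2)] by (simp add: e_def inner_add_right)
  define k where "k = n \<bullet> (a - c)"
  define h where "h = f \<bullet> (a + e - c)"
  have nx: "n \<bullet> b \<le> n \<bullet> x" "n \<bullet> x \<le> n \<bullet> a" if "x \<in> P" for x
    using a b that by (auto simp: face_def)
  have ne: "n \<bullet> e = 0" by (simp add: e_def)
  have k: "k > 0" "\<forall>x\<in>P. \<bar>(n /\<^sub>R k) \<bullet> (x - c)\<bar> \<le> 1"
  proof -
    have "\<forall>x\<in>P. n \<bullet> (2 *\<^sub>R c - a) \<le> n \<bullet> x \<and> n \<bullet> x \<le> n \<bullet> a"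
      using nx by (auto simp: c2 inner_add_right inner_diff_right ne)
    from normalise_strip[OF this width_pos_ex[OF n]]
    show "k > 0" "\<forall>x\<in>P. \<bar>(n /\<^sub>R k) \<bullet> (x - c)\<bar> \<le> 1" unfolding k_def by blast+
  qed
  have h: "h > 0" "\<forall>x\<in>P. \<bar>(f /\<^sub>R h) \<bullet> (x - c)\<bar> \<le> 1"
  proof -
    have "\<forall>x\<in>P. f \<bullet> (2 *\<^sub>R c - (a + e)) \<le> f \<bullet> x \<and> f \<bullet> x \<le> f \<bullet> (a + e)"
      using f(2) fab by (auto simp: c2 e_def inner_add_right inner_diff_right)
    from normalise_strip[OF this width_pos_ex[OF f(1)]]
    show "h > 0" "\<forall>x\<in>P. \<bar>(f /\<^sub>R h) \<bullet> (x - c)\<bar> \<le> 1" unfolding h_def by blast+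
  qed
  define p where "p = a - c"
  define r where "r = a + e - c"
  define q where "q = a + (1/2) *\<^sub>R e - c"
  have "c - p = b + e" "c - r = b" "c + p = a" "c + r = a + e"
    using c2 by (auto simp: p_def r_def scaleR_2 algebra_simps)
  then have pr: "c + p \<in> P" "c - p \<in> P" "c + r \<in> P" "c - r \<in> P" using P by auto
  have q2: "q = (1/2) *\<^sub>R p + (1/2) *\<^sub>R r"
    by (simp add: p_def q_def r_def vec_eq_iff field_simps)
  have "c + q = (1/2) *\<^sub>R (c + p) + (1/2) *\<^sub>R (c + r)" "c - q = (1/2) *\<^sub>R (c - p) + (1/2) *\<^sub>R (c - r)"
    by (simp_all add: q2 vec_eq_iff field_simps)
  then have "c + q \<in> P" "c - q \<in> P" using pr convexD[OF cvx] by force+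
  moreover have "n \<bullet> p = k" "n \<bullet> r = k" "n \<bullet> q = k"
    by (simp_all add: k_def p_def q_def r_def e_def inner_diff_right inner_add_right)
  moreover have fr: "f \<bullet> r = h" by (simp add: h_def r_def)
  moreover have fp: "f \<bullet> p = - h"
  proof -
    have "2 * (f \<bullet> c) = f \<bullet> a + f \<bullet> b + f \<bullet> e"
      using arg_cong[OF c2, of "\<lambda>x. f \<bullet> x"] by (simp add: inner_add_right)
    then show ?thesis using fab by (simp add: h_def p_def inner_add_right inner_diff_right)
  qed
  moreover have "f \<bullet> q = 0" using fr fp by (simp add: q2 inner_add_right)
  moreover have "q \<noteq> r" using n l by (simp add: q_def r_def e_def)
  ultimately have "hexagonal P c p q r"
    unfolding hexagonal_def using cvx pr k h
    by (intro conjI exI[of _ "n /\<^sub>R k"] exI[of _ "f /\<^sub>R h"]) auto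
  then show ?thesis by blast
qed

text \<open>Take an edge with normal \<open>n\<close>, the edge with normal \<open>m\<close> that follows it at the vertex \<open>z\<close>, and the
opposite edges, which meet in a vertex \<open>b\<close>. Let \<open>E1\<close>, \<open>E2\<close> be the edge vectors, so that
\<open>z\<close>, \<open>z - E1\<close>, \<open>z - E2\<close>, \<open>b\<close>, \<open>b + E1\<close>, \<open>b + E2\<close> are points of \<open>P\<close>. The neighbours across the two
edges are translated by \<open>z - b - E1\<close> and \<open>z - b - E2\<close>. The difference \<open>E2 - E1\<close> of these vectors is
also the difference of \<open>z - E1\<close> and \<open>z - E2\<close> and of \<open>b + E2\<close> and \<open>b + E1\<close>. The functional separating
the two neighbours therefore has its maximum over \<open>P\<close> at \<open>z - E1\<close> and \<open>b + E2\<close>, and its minimum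
at \<open>z - E2\<close> and \<open>b + E1\<close>, so the six points are the vertices of a hexagon with \<open>P\<close> inside its strips.\<close>

theorem hexagonal_if_polygon:
  assumes V: "P = convex hull V" "finite V"
  shows "\<exists>c p q r. hexagonal P c p q r"
proof -
  obtain n a l where n: "n \<noteq> 0" and l: "l > 0"
    and F: "face P n = {a + r *\<^sub>R perp n | r. 0 \<le> r \<and> r \<le> l}"
  proof -
    \<comment> \<open>If an arbitrary supporting line touches \<open>P\<close> in a single point, turning it about that point finds an edge.\<close>
    define n0 :: "real^2" where "n0 = axis 1 1"
    have n0: "n0 \<noteq> 0" by (simp add: n0_def axis_eq_0_iff)
    obtain a l where al: "l \<ge> 0" "face P n0 = {a + r *\<^sub>R perp n0 | r. 0 \<le> r \<and> r \<le> l}"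
      by (rule face_segment_ex[OF cpt cvx nonempty n0])
    show thesis
    proof (cases "l = 0")
      case False
      then have "l > 0" using al(1) by simp
      then show thesis by (rule that[OF n0 _ al(2)])
    next
      case True
      then have single: "face P n0 = {a}" using al by auto
      then have "a \<in> face P n0" by simp
      then have a: "a \<in> P" "\<And>x. x \<in> P \<Longrightarrow> n0 \<bullet> x \<le> n0 \<bullet> a"
        by (auto simp: face_def)
      have only: "x = a" if "x \<in> P" "n0 \<bullet> x = n0 \<bullet> a" for x
      proof -
        have "x \<in> face P n0" using that a by (auto simp: face_def)
        then show ?thesis using single by auto
      qed
      obtain x y where xy: "x \<in> P" "y \<in> P" "n0 \<bullet> y < n0 \<bullet> x" using width_pos[OF n0] by blast
      then have lt: "n0 \<bullet> y < n0 \<bullet> a" using a(2)[OF xy(1)] by simp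
      have le: "perp n0 \<bullet> x \<le> perp n0 \<bullet> a" if "x \<in> P" "n0 \<bullet> x = n0 \<bullet> a" for x
        using only[OF that] by simp
      obtain v \<kappa> where v: "v \<in> P" "n0 \<bullet> v < n0 \<bullet> a" "(perp n0 + \<kappa> *\<^sub>R n0) \<bullet> v = (perp n0 + \<kappa> *\<^sub>R n0) \<bullet> a"
        "\<forall>x\<in>P. (perp n0 + \<kappa> *\<^sub>R n0) \<bullet> x \<le> (perp n0 + \<kappa> *\<^sub>R n0) \<bullet> a"
        by (rule next_supporting_line[OF V a xy(2) lt le])
      define m where "m = perp n0 + \<kappa> *\<^sub>R n0"
      have "perp n0 \<bullet> m \<noteq> 0" using n0 by (simp add: m_def inner_add_right)
      then have "m \<noteq> 0" by auto
      moreover have "a \<in> face P m" "v \<in> face P m" using a(1) v by (auto simp: face_def m_def)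
      moreover have "a \<noteq> v" using v by auto
      ultimately obtain a' l' where "l' > 0" "face P m = {a' + r *\<^sub>R perp m | r. 0 \<le> r \<and> r \<le> l'}"
        by (rule edge_if_two_points)
      then show thesis by (rule that[OF \<open>m \<noteq> 0\<close>])
    qed
  qed
  define e where "e = perp n"
  have ee: "e \<bullet> e > 0" using n by (simp add: e_def)
  have nn: "n \<bullet> n > 0" using n by simp
  have ne: "n \<bullet> e = 0" "e \<bullet> n = 0" by (simp_all add: e_def)
  obtain b where F': "face P (- n) = {b + r *\<^sub>R perp n | r. 0 \<le> r \<and> r \<le> l}" and
    alt: "a - b \<in> T \<or> (\<exists>f. f \<noteq> 0 \<and> (\<forall>x\<in>P. f \<bullet> b \<le> f \<bullet> x \<and> f \<bullet> x \<le> f \<bullet> (b + l *\<^sub>R perp n)))"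
    by (rule opposite_edges[OF n F l])
  have aF: "a \<in> face P n" "a + l *\<^sub>R perp n \<in> face P n"
    unfolding F using l by (simp_all add: segment_ends less_imp_le del: mem_Collect_eq)
  have bF: "b \<in> face P (- n)" "b + l *\<^sub>R perp n \<in> face P (- n)"
    unfolding F' using l by (simp_all add: segment_ends less_imp_le del: mem_Collect_eq)
  define z where "z = a + l *\<^sub>R e"
  have zF: "z \<in> face P n" using aF by (simp add: z_def e_def)
  have z: "z \<in> P" "\<And>x. x \<in> P \<Longrightarrow> n \<bullet> x \<le> n \<bullet> z" using zF by (auto simp: face_def)
  have b: "b \<in> P" "\<And>x. x \<in> P \<Longrightarrow> (- n) \<bullet> x \<le> (- n) \<bullet> b" using bF by (auto simp: face_def)
  obtain x1 x0 where "x1 \<in> P" "x0 \<in> P" "n \<bullet> x0 < n \<bullet> x1" using width_pos[OF n] by blast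
  then have x0: "x0 \<in> P" "n \<bullet> x0 < n \<bullet> z" and x1: "x1 \<in> P" "(- n) \<bullet> x1 < (- n) \<bullet> b"
    using z b by force+
  have dz: "e \<bullet> x \<le> e \<bullet> z" if x: "x \<in> P" "n \<bullet> x = n \<bullet> z" for x
  proof -
    have "x \<in> face P n" using x z by (auto simp: face_def)
    then obtain r where "x = a + r *\<^sub>R e" "r \<le> l" by (auto simp: F e_def)
    then show ?thesis using ee by (simp add: z_def inner_add_right)
  qed
  have db: "(- e) \<bullet> x \<le> (- e) \<bullet> b" if x: "x \<in> P" "(- n) \<bullet> x = (- n) \<bullet> b" for x
  proof -
    have "x \<in> face P (- n)" using x b by (auto simp: face_def)
    then obtain r where "x = b + r *\<^sub>R e" "0 \<le> r" by (auto simp: F' e_def)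
    then show ?thesis using ee by (simp add: inner_add_right)
  qed
  obtain v \<kappa> where v: "v \<in> P" "n \<bullet> v < n \<bullet> z" "(e + \<kappa> *\<^sub>R n) \<bullet> v = (e + \<kappa> *\<^sub>R n) \<bullet> z"
    "\<forall>x\<in>P. (e + \<kappa> *\<^sub>R n) \<bullet> x \<le> (e + \<kappa> *\<^sub>R n) \<bullet> z"
    by (rule next_supporting_line[OF V z x0 dz])
  obtain v' \<kappa>' where v': "v' \<in> P" "(- n) \<bullet> v' < (- n) \<bullet> b"
    "(- e + \<kappa>' *\<^sub>R (- n)) \<bullet> v' = (- e + \<kappa>' *\<^sub>R (- n)) \<bullet> b"
    "\<forall>x\<in>P. (- e + \<kappa>' *\<^sub>R (- n)) \<bullet> x \<le> (- e + \<kappa>' *\<^sub>R (- n)) \<bullet> b"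
    by (rule next_supporting_line[OF V b x1 db])
  define m where "m = e + \<kappa> *\<^sub>R n"
  define m' where "m' = - e + \<kappa>' *\<^sub>R (- n)"
  have "e \<bullet> m \<noteq> 0" "e \<bullet> m' \<noteq> 0" using ee by (simp_all add: m_def m'_def inner_add_right inner_diff_right ne)
  then have m0: "m \<noteq> 0" "m' \<noteq> 0" by auto
  have zm: "z \<in> face P m" "v \<in> face P m" "z \<noteq> v" using v z by (auto simp: m_def face_def)
  have bm': "b \<in> face P m'" "v' \<in> face P m'" "b \<noteq> v'" using v' b by (auto simp: m'_def face_def)
  \<comment> \<open>The normals of edges come in opposite pairs. If \<open>-m'\<close> were different from \<open>m\<close>, one of the two would
lie strictly between \<open>n\<close> and the other one, or the same would hold for the opposite normals; but a
normal strictly between those of two edges with a common vertex has only this vertex as its face.\<close>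
  have "\<kappa> = \<kappa>'"
  proof (rule linorder_cases[of \<kappa> \<kappa>'])
    assume less: "\<kappa> < \<kappa>'"
    obtain x y where xy: "x \<in> face P (- m')" "y \<in> face P (- m')" "x \<noteq> y"
      by (rule opposite_face_two_points[OF m0(2) bm'])
    have "x = z" if x: "x \<in> face P (- m')" for x
    proof -
      have "x \<in> P" and le: "(- m') \<bullet> z \<le> (- m') \<bullet> x" using x z by (auto simp: face_def)
      have eq: "- m' = m + (\<kappa>' - \<kappa>) *\<^sub>R n" by (simp add: m_def m'_def algebra_simps)
      have 1: "m \<bullet> x \<le> m \<bullet> z" using zm(1) \<open>x \<in> P\<close> by (simp add: face_def)
      have 2: "n \<bullet> x \<le> n \<bullet> z" using z \<open>x \<in> P\<close> by simp
      have 3: "m \<bullet> z + (\<kappa>' - \<kappa>) * (n \<bullet> z) \<le> m \<bullet> x + (\<kappa>' - \<kappa>) * (n \<bullet> x)"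
        using le by (simp only: eq inner_add_left inner_scaleR_left)
      have "(\<kappa>' - \<kappa>) * (n \<bullet> x) \<le> (\<kappa>' - \<kappa>) * (n \<bullet> z)" using 2 less by simp
      with 1 3 have "m \<bullet> x = m \<bullet> z" "(\<kappa>' - \<kappa>) * (n \<bullet> x) = (\<kappa>' - \<kappa>) * (n \<bullet> z)" by linarith+
      then have "n \<bullet> (x - z) = 0" "e \<bullet> (x - z) = 0"
        using less by (auto simp: m_def inner_add_left inner_diff_right)
      then show ?thesis using eq_0_if_inner_eq_0_both[OF n, of "x - z"] by (simp add: e_def)
    qed
    then show ?thesis using xy by auto
  next
    assume less: "\<kappa>' < \<kappa>"
    obtain x y where xy: "x \<in> face P (- m)" "y \<in> face P (- m)" "x \<noteq> y"
      by (rule opposite_face_two_points[OF m0(1) zm])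
    have "x = b" if x: "x \<in> face P (- m)" for x
    proof -
      have "x \<in> P" and le: "(- m) \<bullet> b \<le> (- m) \<bullet> x" using x b by (auto simp: face_def)
      have eq: "- m = m' + (\<kappa> - \<kappa>') *\<^sub>R (- n)" by (simp add: m_def m'_def algebra_simps)
      have 1: "m' \<bullet> x \<le> m' \<bullet> b" using bm'(1) \<open>x \<in> P\<close> by (simp add: face_def)
      have 2: "(- n) \<bullet> x \<le> (- n) \<bullet> b" using b \<open>x \<in> P\<close> by blast
      have 3: "m' \<bullet> b + (\<kappa> - \<kappa>') * ((- n) \<bullet> b) \<le> m' \<bullet> x + (\<kappa> - \<kappa>') * ((- n) \<bullet> x)"
        using le by (simp only: eq inner_add_left inner_scaleR_left)
      have "(\<kappa> - \<kappa>') * ((- n) \<bullet> x) \<le> (\<kappa> - \<kappa>') * ((- n) \<bullet> b)" using 2 less by (intro mult_left_mono) auto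
      with 1 3 have "m' \<bullet> x = m' \<bullet> b" "(\<kappa> - \<kappa>') * ((- n) \<bullet> x) = (\<kappa> - \<kappa>') * ((- n) \<bullet> b)" by linarith+
      then have "n \<bullet> (x - b) = 0" "e \<bullet> (x - b) = 0"
        using less by (auto simp: m'_def inner_add_left inner_diff_right inner_diff_left)
      then show ?thesis using eq_0_if_inner_eq_0_both[OF n, of "x - b"] by (simp add: e_def)
    qed
    then show ?thesis using xy by auto
  qed
  then have m': "m' = - m" by (simp add: m_def m'_def)
  obtain a2 l2 where l2: "l2 > 0" and F2: "face P m = {a2 + r *\<^sub>R perp m | r. 0 \<le> r \<and> r \<le> l2}"
    by (rule edge_if_two_points[OF m0(1) zm])
  obtain b2 where F2': "face P (- m) = {b2 + r *\<^sub>R perp m | r. 0 \<le> r \<and> r \<le> l2}" and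
    alt2: "a2 - b2 \<in> T \<or> (\<exists>f. f \<noteq> 0 \<and> (\<forall>x\<in>P. f \<bullet> b2 \<le> f \<bullet> x \<and> f \<bullet> x \<le> f \<bullet> (b2 + l2 *\<^sub>R perp m)))"
    by (rule opposite_edges[OF m0(1) F2 l2])
  have a2F: "a2 \<in> face P m" "a2 + l2 *\<^sub>R perp m \<in> face P m"
    unfolding F2 using l2 by (simp_all add: segment_ends less_imp_le del: mem_Collect_eq)
  have b2F: "b2 \<in> face P (- m)" "b2 + l2 *\<^sub>R perp m \<in> face P (- m)"
    unfolding F2' using l2 by (simp_all add: segment_ends less_imp_le del: mem_Collect_eq)
  have perpm: "n \<bullet> perp m = - (n \<bullet> n)"
    by (simp add: m_def e_def inner_real2 algebra_simps)
  have a2: "a2 = z"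
  proof -
    obtain r where r: "z = a2 + r *\<^sub>R perp m" "0 \<le> r" using zm(1) by (auto simp: F2)
    have "n \<bullet> a2 \<le> n \<bullet> z" using z(2) a2F by (auto simp: face_def)
    then have "r * (n \<bullet> n) \<le> 0" by (simp add: r(1) inner_add_right perpm)
    then have "r = 0" using r(2) nn by (simp add: mult_le_0_iff)
    then show ?thesis using r by simp
  qed
  have b2: "b2 + l2 *\<^sub>R perp m = b"
  proof -
    obtain r where r: "b = b2 + r *\<^sub>R perp m" "r \<le> l2" using bm'(1) by (auto simp: F2' m')
    have "(-n) \<bullet> (b2 + l2 *\<^sub>R perp m) \<le> (-n) \<bullet> b" using b(2) b2F unfolding face_def by blast
    then have "(l2 - r) * (n \<bullet> n) \<le> 0" by (simp add: r(1) inner_add_right perpm algebra_simps)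
    then have "r = l2" using r(2) nn by (simp add: mult_le_0_iff)
    then show ?thesis using r by simp
  qed
  show ?thesis
  proof (cases "a - b \<in> T \<and> a2 - b2 \<in> T \<and> a \<noteq> b2")
    case False
    \<comment> \<open>If the edges from \<open>z\<close> and \<open>b\<close> already meet at \<open>a = b2\<close>, the strips of \<open>n\<close> and \<open>m\<close> bound a parallelogram.\<close>
    have "\<forall>x\<in>P. m \<bullet> b \<le> m \<bullet> x \<and> m \<bullet> x \<le> m \<bullet> (b + l *\<^sub>R perp n)" if "a = b2"
    proof -
      have mz: "m \<bullet> z = m \<bullet> a + l * (e \<bullet> e)" by (simp add: z_def m_def inner_add_right inner_add_left ne)
      have mb: "m \<bullet> (b + l *\<^sub>R perp n) = m \<bullet> b + l * (e \<bullet> e)"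
        by (simp add: m_def inner_add_right inner_add_left ne flip: e_def)
      have "m \<bullet> a = m \<bullet> b"
        using bm'(1) b2F(1) b(1) that unfolding m' by (auto simp: face_def intro: antisym)
      then show ?thesis using mz mb zm(1) bm'(1) unfolding m' face_def by auto
    qed
    then have "\<exists>c p q r. hexagonal P c p q r" if "a = b2"
      using hexagonal_if_parallelogram[OF n l aF bF m0(1)] that by blast
    with False show ?thesis
      using alt alt2 hexagonal_if_parallelogram[OF n l aF bF]
        hexagonal_if_parallelogram[OF m0(1) l2 a2F b2F] by blast
  next
    case True
    define E1 where "E1 = l *\<^sub>R e"
    define E2 where "E2 = - l2 *\<^sub>R perp m"
    have nE: "n \<bullet> E1 = 0" "n \<bullet> E2 > 0"
      using nn l2 by (simp_all add: E1_def E2_def ne perpm)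
    have mE: "m \<bullet> E1 > 0" using ee l by (simp add: E1_def m_def inner_add_left ne)
    have pts: "z = a + E1" "b2 = b + E2" "a2 + l2 *\<^sub>R perp m = z - E2"
      using b2 a2 by (auto simp: z_def E1_def E2_def algebra_simps)
    have inP: "a \<in> P" "b2 \<in> P" "z - E2 \<in> P" "b + E1 \<in> P"
      using aF b2F a2F bF by (auto simp: face_def pts(3)[symmetric] E1_def e_def)
    have diff: "(a - b) - (a2 - b2) = E2 - E1"
      using pts a2 by (simp add: algebra_simps)
    have "E2 - E1 \<noteq> 0" using nE by auto
    then have "a2 - b2 \<noteq> a - b" using diff by auto
    then obtain f where f: "f \<noteq> 0" "\<forall>x\<in>P. \<forall>y\<in>P. f \<bullet> (x - y) \<le> f \<bullet> (E2 - E1)"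
      using separated[of "a2 - b2" "a - b"] True diff by auto
    define c where "c = (1/2) *\<^sub>R (z + b)"
    have c2: "2 *\<^sub>R c = z + b" by (simp add: c_def)
    have c2': "2 * (g \<bullet> c) = g \<bullet> z + g \<bullet> b" for g
      using arg_cong[OF c2, of "\<lambda>x. g \<bullet> x"] by (simp add: inner_add_right)
    define p where "p = z - c"
    define q where "q = a - c"
    define r where "r = b2 - c"
    define k where "k = n \<bullet> (z - c)"
    define h where "h = f \<bullet> (a - c)"
    define j where "j = (- m) \<bullet> (b - c)"
    have nb: "n \<bullet> b \<le> n \<bullet> x" if "x \<in> P" for x using b(2)[OF that] by simp
    have mx: "m \<bullet> b \<le> m \<bullet> x" "m \<bullet> x \<le> m \<bullet> z" if "x \<in> P" for x
      using zm(1) bm'(1) that by (auto simp: face_def m')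
    have k: "k > 0" "\<forall>x\<in>P. \<bar>(n /\<^sub>R k) \<bullet> (x - c)\<bar> \<le> 1"
    proof -
      have "\<forall>x\<in>P. n \<bullet> (2 *\<^sub>R c - z) \<le> n \<bullet> x \<and> n \<bullet> x \<le> n \<bullet> z"
        using z(2) nb by (simp add: c2)
      from normalise_strip[OF this width_pos_ex[OF n]]
      show "k > 0" "\<forall>x\<in>P. \<bar>(n /\<^sub>R k) \<bullet> (x - c)\<bar> \<le> 1" unfolding k_def by blast+
    qed
    have j: "j > 0" "\<forall>x\<in>P. \<bar>((- m) /\<^sub>R j) \<bullet> (x - c)\<bar> \<le> 1"
    proof -
      have "\<forall>x\<in>P. (- m) \<bullet> (2 *\<^sub>R c - b) \<le> (- m) \<bullet> x \<and> (- m) \<bullet> x \<le> (- m) \<bullet> b"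
        using mx by (simp add: c2)
      moreover have "- m \<noteq> 0" using m0 by simp
      ultimately show "j > 0" "\<forall>x\<in>P. \<bar>((- m) /\<^sub>R j) \<bullet> (x - c)\<bar> \<le> 1"
        unfolding j_def using normalise_strip[OF _ width_pos_ex[of "- m"]] by blast+
    qed
    have fx: "f \<bullet> (b + E1) \<le> f \<bullet> x" "f \<bullet> x \<le> f \<bullet> a" if "x \<in> P" for x
      using f(2)[rule_format, OF that inP(3)] f(2)[rule_format, OF inP(2) that] pts
      by (auto simp: inner_diff_right inner_add_right)
    have c2a: "2 *\<^sub>R c - a = b + E1" using pts by (simp add: c2)
    have h: "h > 0" "\<forall>x\<in>P. \<bar>(f /\<^sub>R h) \<bullet> (x - c)\<bar> \<le> 1"
    proof -
      have "\<forall>x\<in>P. f \<bullet> (2 *\<^sub>R c - a) \<le> f \<bullet> x \<and> f \<bullet> x \<le> f \<bullet> a"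
        using fx by (simp add: c2a)
      from normalise_strip[OF this width_pos_ex[OF f(1)]]
      show "h > 0" "\<forall>x\<in>P. \<bar>(f /\<^sub>R h) \<bullet> (x - c)\<bar> \<le> 1" unfolding h_def by blast+
    qed
    have fb2: "f \<bullet> b2 = f \<bullet> a"
      using fx(2)[OF inP(2)] f(2)[rule_format, OF inP(1,4)] pts(2)
      by (auto simp: inner_diff_right inner_add_right)
    have mb2: "m \<bullet> b2 = m \<bullet> b"
      using bm'(1) b2F(1) b(1) unfolding m' by (auto simp: face_def intro: antisym)
    have sym: "c - p = b" "c - q = b + E1" "c - r = z - E2" "c + p = z" "c + q = a" "c + r = b2"
      using c2 c2a pts by (auto simp: p_def q_def r_def scaleR_2 algebra_simps)
    have sub: "{c + p, c - p, c + q, c - q, c + r, c - r} \<subseteq> P"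
      unfolding sym using inP z(1) b(1) by simp
    have np: "n \<bullet> p = k" "n \<bullet> q = k"
      using pts(1) nE by (simp_all add: p_def q_def k_def inner_add_right inner_diff_right)
    have fq: "f \<bullet> q = h" "f \<bullet> r = h"
      using fb2 by (simp_all add: q_def r_def h_def inner_diff_right)
    have mr: "m \<bullet> r = - j" "m \<bullet> p = j"
      using mb2 c2'[of m] by (simp_all add: p_def r_def j_def inner_diff_right)
    have nr: "n \<bullet> r > - k"
      using nE(2) c2'[of n] pts(2) by (simp add: r_def k_def inner_diff_right inner_add_right)
    have mq: "m \<bullet> q < j"
      using mE c2'[of m] pts(1) by (simp add: q_def j_def inner_diff_right inner_add_right)
    have bound: "\<forall>x\<in>P. \<bar>(n /\<^sub>R k) \<bullet> (x - c)\<bar> \<le> 1 \<and> \<bar>(f /\<^sub>R h) \<bullet> (x - c)\<bar> \<le> 1 \<and>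
        \<bar>((- m) /\<^sub>R j) \<bullet> (x - c)\<bar> \<le> 1"
      using k(2) h(2) j(2) by blast
    have "(n /\<^sub>R k) \<bullet> p = 1" "(n /\<^sub>R k) \<bullet> q = 1" "(f /\<^sub>R h) \<bullet> q = 1" "(f /\<^sub>R h) \<bullet> r = 1"
      "((- m) /\<^sub>R j) \<bullet> r = 1" "((- m) /\<^sub>R j) \<bullet> p = -1"
      using k(1) h(1) j(1) by (simp_all add: np fq mr)
    moreover have "(n /\<^sub>R k) \<bullet> r > - 1" "((- m) /\<^sub>R j) \<bullet> q > - 1"
      using k(1) j(1) nr mq by (simp_all add: field_simps)
    moreover have "q \<noteq> r" using True by (simp add: q_def r_def)
    ultimately have "hexagonal P c p q r"
      unfolding hexagonal_def using cvx sub bound by blast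
    then show ?thesis by blast
  qed
qed

end

lemma separated_if_disjoint_interiors:
  fixes P :: "'a::euclidean_space set"
  assumes P: "convex P" "interior P \<noteq> {}"
    and disj: "interior ((+) s ` P) \<inter> interior ((+) t ` P) = {}"
  shows "\<exists>f. f \<noteq> 0 \<and> (\<forall>x\<in>P. \<forall>y\<in>P. f \<bullet> (x - y) \<le> f \<bullet> (t - s))"
proof -
  have cvx: "convex ((+) r ` P)" and ne: "interior ((+) r ` P) \<noteq> {}" for r
    using P by (auto simp: convex_translation interior_translation)
  obtain f b where f: "f \<noteq> 0" "\<forall>x\<in>interior ((+) s ` P). f \<bullet> x \<le> b" "\<forall>x\<in>interior ((+) t ` P). b \<le> f \<bullet> x"
    using separating_hyperplane_sets[OF convex_interior[OF cvx] convex_interior[OF cvx] ne ne disj] by blast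
  have "closure (interior ((+) s ` P)) \<subseteq> {x. f \<bullet> x \<le> b}"
    by (rule closure_minimal) (use f in \<open>auto simp: closed_halfspace_le\<close>)
  then have 1: "(+) s ` P \<subseteq> {x. f \<bullet> x \<le> b}"
    using convex_closure_interior[OF cvx ne] closure_subset by blast
  have "closure (interior ((+) t ` P)) \<subseteq> {x. f \<bullet> x \<ge> b}"
    by (rule closure_minimal) (use f in \<open>auto simp: closed_halfspace_ge\<close>)
  then have 2: "(+) t ` P \<subseteq> {x. f \<bullet> x \<ge> b}"
    using convex_closure_interior[OF cvx ne] closure_subset by blast
  have "f \<bullet> (x - y) \<le> f \<bullet> (t - s)" if "x \<in> P" "y \<in> P" for x y
  proof -
    have "f \<bullet> (s + x) \<le> b" "b \<le> f \<bullet> (t + y)" using 1 2 that by auto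
    then show ?thesis by (simp add: inner_add_right inner_diff_right)
  qed
  then show ?thesis using f(1) by blast
qed

theorem hexagonal_if_tessellating:
  assumes "P \<in> tessellating_polygons"
  shows "\<exists>c p q r. hexagonal P c p q r"
proof -
  have poly: "polytope P" and int: "interior P \<noteq> {}"
    using assms by (auto simp: tessellating_polygons_def convex_polygon_def)
  obtain T where cover: "(\<Union>t\<in>T. (+) t ` P) = UNIV" and
    disj: "\<And>s t. s \<in> T \<Longrightarrow> t \<in> T \<Longrightarrow> s \<noteq> t \<Longrightarrow> interior ((+) s ` P) \<inter> interior ((+) t ` P) = {}"
    using assms unfolding tessellating_polygons_def tessellates_by_translations_def by blast
  obtain t0 where t0: "t0 \<in> T" using cover by auto
  obtain V where V: "finite V" "P = convex hull V" using poly polytope_def by auto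
  interpret translative_tiling P "(\<lambda>t. t - t0) ` T"
  proof
    show "compact P" "convex P" using poly by (auto simp: polytope_imp_compact polytope_imp_convex)
    then show "\<exists>f. f \<noteq> 0 \<and> (\<forall>x\<in>P. \<forall>y\<in>P. f \<bullet> (x - y) \<le> f \<bullet> (t - s))"
      if st: "s \<in> (\<lambda>t. t - t0) ` T" "t \<in> (\<lambda>t. t - t0) ` T" "s \<noteq> t" for s t
    proof -
      obtain s' t' where "s' \<in> T" "t' \<in> T" "s = s' - t0" "t = t' - t0" using st by auto
      then show ?thesis
        using separated_if_disjoint_interiors[OF \<open>convex P\<close> int disj, of s' t'] st(3) by auto
    qed
    show "interior P \<noteq> {}" by fact
    show "0 \<in> (\<lambda>t. t - t0) ` T" using t0 by force
    show "\<exists>t\<in>(\<lambda>t. t - t0) ` T. z - t \<in> P" for z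
    proof -
      have "z + t0 \<in> (\<Union>t\<in>T. (+) t ` P)" using cover by simp
      then obtain t x where "t \<in> T" "x \<in> P" "z + t0 = t + x" by auto
      moreover from this have "z - (t - t0) = x" by (simp add: algebra_simps)
      ultimately show ?thesis by auto
    qed
  qed
  show ?thesis by (rule hexagonal_if_polygon[OF V(2,1)])
qed

section \<open>The length of a segment as a Hausdorff measure\<close>

text \<open>Orthogonal projection to the line does not increase distances, so it maps a covering set into an
interval no longer than its diameter, and Lebesgue measure on the line is countably subadditive.\<close>

lemma length_le_sum_diameters:
  fixes v y :: "'a::real_inner"
  assumes v: "norm v = 1" and le: "lo \<le> hi"
    and sub: "{y + r *\<^sub>R v | r. lo \<le> r \<and> r \<le> hi} \<subseteq> (\<Union>i::nat. C i)"
    and bd: "\<And>i. bounded (C i)"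
  shows "ennreal (hi - lo) \<le> (\<Sum>i. ennreal (diameter (C i)))"
proof -
  define g where "g x = (x - y) \<bullet> v" for x
  have vv: "v \<bullet> v = 1" using v by (simp add: dot_square_norm)
  have lip: "\<bar>g x - g x'\<bar> \<le> dist x x'" for x x'
  proof -
    have "g x - g x' = (x - x') \<bullet> v" by (simp add: g_def inner_diff_left)
    then show ?thesis using Cauchy_Schwarz_ineq2[of "x - x'" v] v by (simp add: dist_norm)
  qed
  have ex: "\<exists>a. g ` C i \<subseteq> {a..a + diameter (C i)}" for i
  proof (cases "C i = {}")
    case False
    have "bdd_below (g ` C i)"
    proof -
      obtain x0 where x0: "x0 \<in> C i" using False by auto
      have "g x0 - diameter (C i) \<le> g x" if "x \<in> C i" for x
        using lip[of x0 x] diameter_bounded_bound[OF bd x0 that] by linarith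
      then show ?thesis by (intro bdd_belowI2)
    qed
    then have "Inf (g ` C i) \<le> g x" if "x \<in> C i" for x using that by (intro cInf_lower) auto
    moreover have "g x \<le> Inf (g ` C i) + diameter (C i)" if x: "x \<in> C i" for x
    proof -
      have "g x - diameter (C i) \<le> Inf (g ` C i)"
      proof (rule cInf_greatest)
        fix w assume "w \<in> g ` C i"
        then obtain x' where x': "x' \<in> C i" "w = g x'" by auto
        show "g x - diameter (C i) \<le> w"
          using lip[of x x'] diameter_bounded_bound[OF bd x x'(1)] x' by linarith
      qed (use False in auto)
      then show ?thesis by simp
    qed
    ultimately show ?thesis by (intro exI[of _ "Inf (g ` C i)"]) auto
  qed auto
  then obtain a where a: "\<And>i. g ` C i \<subseteq> {a i..a i + diameter (C i)}" by metis
  have "{lo..hi} \<subseteq> (\<Union>i. {a i..a i + diameter (C i)})"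
  proof
    fix r assume "r \<in> {lo..hi}"
    then have "y + r *\<^sub>R v \<in> (\<Union>i. C i)" using sub by auto
    then obtain i where "y + r *\<^sub>R v \<in> C i" by blast
    then have "g (y + r *\<^sub>R v) \<in> {a i..a i + diameter (C i)}" using a by blast
    then show "r \<in> (\<Union>i. {a i..a i + diameter (C i)})" using vv by (auto simp: g_def)
  qed
  then have "emeasure lborel {lo..hi} \<le> emeasure lborel (\<Union>i. {a i..a i + diameter (C i)})"
    by (intro emeasure_mono) auto
  also have "\<dots> \<le> (\<Sum>i. emeasure lborel {a i..a i + diameter (C i)})"
    by (intro emeasure_subadditive_countably) auto
  also have "\<dots> = (\<Sum>i. ennreal (diameter (C i)))"
    using diameter_ge_0[OF bd] by (intro suminf_cong) simp
  finally show ?thesis using le by simp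
qed

lemma segment_fine_cover:
  fixes v y :: "'a::real_inner"
  assumes v: "norm v = 1" and le: "lo \<le> hi" and d: "0 < \<delta>"
  shows "\<exists>C::nat \<Rightarrow> 'a set. {y + r *\<^sub>R v | r. lo \<le> r \<and> r \<le> hi} \<subseteq> (\<Union>i. C i) \<and>
    (\<forall>i. bounded (C i) \<and> diameter (C i) \<le> \<delta>) \<and> (\<Sum>i. ennreal (diameter (C i))) \<le> ennreal (hi - lo)"
proof -
  obtain N :: nat where N: "N > 0" "(hi - lo) / \<delta> < real N"
    using reals_Archimedean2 by (metis gr0I le divide_nonneg_pos diff_ge_0_iff_ge d not_less of_nat_0)
  define h where "h = (hi - lo) / real N"
  have h: "0 \<le> h" "h \<le> \<delta>" "real N * h = hi - lo"
    using N le d by (auto simp: h_def field_simps)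
  define C where "C i = (if i < N then (\<lambda>r. y + r *\<^sub>R v) ` {lo + real i * h..lo + real (Suc i) * h} else {})" for i
  have diam: "diameter (C i) \<le> h" for i
  proof (rule diameter_le)
    fix x x' assume "x \<in> C i" "x' \<in> C i"
    then have "i < N" "x \<in> (\<lambda>r. y + r *\<^sub>R v) ` {lo + real i * h..lo + real (Suc i) * h}"
      "x' \<in> (\<lambda>r. y + r *\<^sub>R v) ` {lo + real i * h..lo + real (Suc i) * h}"
      by (simp_all add: C_def split: if_splits)
    then obtain r r' where r: "x = y + r *\<^sub>R v" "r \<in> {lo + real i * h..lo + real (Suc i) * h}"
      "x' = y + r' *\<^sub>R v" "r' \<in> {lo + real i * h..lo + real (Suc i) * h}"
      by blast
    have "x - x' = (r - r') *\<^sub>R v" using r by (simp add: algebra_simps)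
    moreover have "\<bar>r - r'\<bar> \<le> h" using r by (auto simp: algebra_simps abs_le_iff)
    ultimately show "norm (x - x') \<le> h" using v by simp
  qed (use h in auto)
  have bdC: "bounded (C i)" for i
    unfolding C_def by (auto intro!: compact_imp_bounded compact_continuous_image continuous_intros)
  have "{y + r *\<^sub>R v | r. lo \<le> r \<and> r \<le> hi} \<subseteq> (\<Union>i. C i)"
  proof
    fix x assume "x \<in> {y + r *\<^sub>R v | r. lo \<le> r \<and> r \<le> hi}"
    then obtain r where r: "x = y + r *\<^sub>R v" "lo \<le> r" "r \<le> hi" by auto
    \<comment> \<open>Otherwise \<open>r\<close> would be to the right of every subdivision point, including the last one, which is \<open>hi\<close>.\<close>
    have "\<exists>i<N. lo + real i * h \<le> r \<and> r \<le> lo + real (Suc i) * h"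
    proof (rule ccontr)
      assume neg: "\<not> (\<exists>i<N. lo + real i * h \<le> r \<and> r \<le> lo + real (Suc i) * h)"
      have "i \<le> N \<Longrightarrow> lo + real i * h \<le> r \<and> (i = 0 \<or> lo + real i * h < r)" for i
      proof (induction i)
        case (Suc i)
        then have "i < N" "lo + real i * h \<le> r" by auto
        then have "\<not> r \<le> lo + real (Suc i) * h" using neg by blast
        then show ?case by simp
      qed (use r in simp)
      then have "lo + real N * h < r" using N by (metis order_refl less_irrefl)
      then show False using h r by simp
    qed
    then show "x \<in> (\<Union>i. C i)" using r by (force simp: C_def)
  qed
  moreover have "(\<Sum>i. ennreal (diameter (C i))) \<le> ennreal (hi - lo)"
  proof -
    have "(\<Sum>i. ennreal (diameter (C i))) = (\<Sum>i<N. ennreal (diameter (C i)))"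
      by (rule suminf_finite) (auto simp: C_def)
    also have "\<dots> \<le> (\<Sum>i<N. ennreal h)" using diam by (intro sum_mono ennreal_leI) auto
    also have "\<dots> = ennreal (hi - lo)" using h by (subst sum_ennreal) simp_all
    finally show ?thesis .
  qed
  moreover have "\<forall>i. bounded (C i) \<and> diameter (C i) \<le> \<delta>"
    using bdC order_trans[OF diam h(2)] by simp
  ultimately show ?thesis by (intro exI[of _ C] conjI)
qed

lemma hausdorff_measure_1_segment:
  fixes v y :: "'a::real_inner"
  assumes v: "norm v = 1" and le: "lo \<le> hi"
  shows "hausdorff_measure_1 {y + r *\<^sub>R v | r. lo \<le> r \<and> r \<le> hi} = ennreal (hi - lo)"
  unfolding hausdorff_measure_1_def
proof (rule antisym)
  let ?S = "{y + r *\<^sub>R v | r. lo \<le> r \<and> r \<le> hi}"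
  let ?\<C> = "\<lambda>\<delta>. {C :: nat \<Rightarrow> 'a set. ?S \<subseteq> (\<Union>i. C i) \<and> (\<forall>i. bounded (C i) \<and> diameter (C i) \<le> \<delta>)}"
  show "(SUP \<delta>\<in>{0<..}. INF C\<in>?\<C> \<delta>. \<Sum>i. ennreal (diameter (C i))) \<le> ennreal (hi - lo)"
  proof (rule SUP_least)
    fix \<delta> :: real assume "\<delta> \<in> {0<..}"
    then obtain C where C: "C \<in> ?\<C> \<delta>" "(\<Sum>i. ennreal (diameter (C i))) \<le> ennreal (hi - lo)"
      using segment_fine_cover[OF v le, of \<delta> y] by blast
    have "(INF C\<in>?\<C> \<delta>. \<Sum>i. ennreal (diameter (C i))) \<le> (\<Sum>i. ennreal (diameter (C i)))"
      using C(1) by (rule INF_lower)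
    also note C(2)
    finally show "(INF C\<in>?\<C> \<delta>. \<Sum>i. ennreal (diameter (C i))) \<le> ennreal (hi - lo)" .
  qed
  have "ennreal (hi - lo) \<le> (INF C\<in>?\<C> 1. \<Sum>i. ennreal (diameter (C i)))"
    by (rule INF_greatest) (use length_le_sum_diameters[OF v le] in blast)
  also have "\<dots> \<le> (SUP \<delta>\<in>{0<..}. INF C\<in>?\<C> \<delta>. \<Sum>i. ennreal (diameter (C i)))"
    by (rule SUP_upper) simp
  finally show "ennreal (hi - lo) \<le> \<dots>" .
qed

section \<open>Steiner symmetrization along parallel chords\<close>

lemma unit_normal_hyperplane:
  assumes v: "norm v = 1"
  shows "unit_normal {x. v \<bullet> x = 0} = v \<or> unit_normal {x. v \<bullet> x = 0} = - v"
proof -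
  let ?w = "unit_normal {x. v \<bullet> x = 0}"
  have "norm ?w = 1 \<and> (\<forall>x\<in>{x. v \<bullet> x = 0}. ?w \<bullet> x = 0)"
    unfolding unit_normal_def by (rule someI[of _ v]) (use v in auto)
  then have w: "norm ?w = 1" "perp v \<bullet> ?w = 0" by (auto simp: inner_commute)
  moreover have "perp v \<noteq> 0" using v by auto
  ultimately obtain k where k: "?w = k *\<^sub>R perp (perp v)"
    using eq_scaleR_perp_if_inner_0 by blast
  moreover have "perp (perp v) = - v" by (simp add: vec_eq_iff forall_2)
  ultimately have "?w = - k *\<^sub>R v" by simp
  moreover from this have "\<bar>k\<bar> = 1" using w v by simp
  ultimately show ?thesis by (auto simp: abs_if split: if_splits)
qed

lemma line_through_origin_hyperplane:
  assumes "v \<noteq> (0::real^2)" shows "line_through_origin {x. v \<bullet> x = 0}"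
  using assms by (simp add: line_through_origin_def subspace_hyperplane dim_hyperplane)

lemma normal_line_hyperplane:
  assumes v: "norm v = 1"
  shows "normal_line {x. v \<bullet> x = 0} x = {x + r *\<^sub>R v | r. True}"
proof -
  have "{x + r *\<^sub>R (- v) | r. True} = {x + r *\<^sub>R v | r. True}"
    by (metis (no_types, opaque_lifting) scaleR_minus_left scaleR_minus_right minus_minus)
  then show ?thesis
    using unit_normal_hyperplane[OF v] unfolding normal_line_def by (elim disjE) simp_all
qed

text \<open>The foot of the perpendicular from \<open>y\<close> to the axis is eliminated, and with it the choice between the
two unit normals: the chord through \<open>y\<close> is the same, and the distance of \<open>y\<close> to the axis is
\<open>\<bar>v \<bullet> y\<bar>\<close>.\<close>

lemma mem_steiner_symmetrization_iff:
  assumes v: "norm v = 1"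
  shows "y \<in> steiner_symmetrization {x. v \<bullet> x = 0} E \<longleftrightarrow>
    {y + r *\<^sub>R v | r. True} \<inter> E \<noteq> {} \<and>
    ennreal (2 * \<bar>v \<bullet> y\<bar>) \<le> hausdorff_measure_1 (E \<inter> {y + r *\<^sub>R v | r. True})"
proof -
  let ?L = "{x. v \<bullet> x = 0}"
  have vv: "v \<bullet> v = 1" using v by (simp add: dot_square_norm)
  have line: "{x + r *\<^sub>R v | r. True} = {y + r *\<^sub>R v | r. True}" if "y = x + s *\<^sub>R v" for x y :: "real^2" and s
  proof (intro set_eqI iffI)
    fix z assume "z \<in> {x + r *\<^sub>R v | r. True}"
    then obtain r where "z = x + r *\<^sub>R v" by blast
    then have "z = y + (r - s) *\<^sub>R v" by (simp add: that algebra_simps)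
    then show "z \<in> {y + r *\<^sub>R v | r. True}" by blast
  next
    fix z assume "z \<in> {y + r *\<^sub>R v | r. True}"
    then obtain r where "z = y + r *\<^sub>R v" by blast
    then have "z = x + (r + s) *\<^sub>R v" by (simp add: that algebra_simps)
    then show "z \<in> {x + r *\<^sub>R v | r. True}" by blast
  qed
  have un: "unit_normal ?L = v \<or> unit_normal ?L = - v" by (rule unit_normal_hyperplane[OF v])
  show ?thesis
  proof
    assume "y \<in> steiner_symmetrization ?L E"
    then obtain x r where x: "v \<bullet> x = 0" "normal_line ?L x \<inter> E \<noteq> {}" "y = x + r *\<^sub>R unit_normal ?L"
      "ennreal (2 * \<bar>r\<bar>) \<le> hausdorff_measure_1 (E \<inter> normal_line ?L x)"
      unfolding steiner_symmetrization_def by blast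
    have "v \<bullet> y = r \<or> v \<bullet> y = - r" using un x vv by (auto simp: inner_add_right)
    then have abs: "\<bar>v \<bullet> y\<bar> = \<bar>r\<bar>" by auto
    have "\<exists>s. y = x + s *\<^sub>R v" using un x(3) by (metis scaleR_minus_right scaleR_minus_left)
    then have "normal_line ?L x = {y + r *\<^sub>R v | r. True}"
      using line normal_line_hyperplane[OF v] by metis
    then show "{y + r *\<^sub>R v | r. True} \<inter> E \<noteq> {} \<and>
      ennreal (2 * \<bar>v \<bullet> y\<bar>) \<le> hausdorff_measure_1 (E \<inter> {y + r *\<^sub>R v | r. True})"
      using x abs by metis
  next
    assume h: "{y + r *\<^sub>R v | r. True} \<inter> E \<noteq> {} \<and>
      ennreal (2 * \<bar>v \<bullet> y\<bar>) \<le> hausdorff_measure_1 (E \<inter> {y + r *\<^sub>R v | r. True})"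
    define x where "x = y - (v \<bullet> y) *\<^sub>R v"
    have yx: "y = x + (v \<bullet> y) *\<^sub>R v" by (simp add: x_def)
    have xL: "x \<in> ?L" using vv by (simp add: x_def inner_diff_right)
    have nl: "normal_line ?L x = {y + r *\<^sub>R v | r. True}"
      using line[OF yx] normal_line_hyperplane[OF v] by metis
    have "\<exists>r. y = x + r *\<^sub>R unit_normal ?L \<and> \<bar>r\<bar> = \<bar>v \<bullet> y\<bar>"
      using un
    proof (elim disjE)
      assume u: "unit_normal ?L = v"
      then show ?thesis by (intro exI[of _ "v \<bullet> y"]) (use yx in auto)
    next
      assume u: "unit_normal ?L = - v"
      then show ?thesis by (intro exI[of _ "- (v \<bullet> y)"]) (use yx in auto)
    qed
    then obtain r where r: "y = x + r *\<^sub>R unit_normal ?L" "\<bar>r\<bar> = \<bar>v \<bullet> y\<bar>" by blast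
    show "y \<in> steiner_symmetrization ?L E"
      unfolding steiner_symmetrization_def
    proof (rule UN_I[of x])
      show "x \<in> {x \<in> ?L. normal_line ?L x \<inter> E \<noteq> {}}" using xL h nl by auto
      show "y \<in> {x + r *\<^sub>R unit_normal ?L |r. ennreal (2 * \<bar>r\<bar>) \<le> hausdorff_measure_1 (E \<inter> normal_line ?L x)}"
        using r h unfolding nl by auto
    qed
  qed
qed

lemma mem_steiner_symmetrization_segment:
  assumes v: "norm v = 1" and le: "lo \<le> hi"
    and sec: "\<And>r. y + r *\<^sub>R v \<in> E \<longleftrightarrow> lo \<le> r \<and> r \<le> hi"
  shows "y \<in> steiner_symmetrization {x. v \<bullet> x = 0} E \<longleftrightarrow> 2 * \<bar>v \<bullet> y\<bar> \<le> hi - lo"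
proof -
  have eq: "E \<inter> {y + r *\<^sub>R v | r. True} = {y + r *\<^sub>R v | r. lo \<le> r \<and> r \<le> hi}"
    using sec by auto
  have "{y + r *\<^sub>R v | r. True} \<inter> E \<noteq> {}" using sec[of lo] le by blast
  then show ?thesis
    unfolding mem_steiner_symmetrization_iff[OF v] eq hausdorff_measure_1_segment[OF v le]
    using le by (simp add: ennreal_le_iff)
qed

section \<open>Chords of a hexagon\<close>

definition axis_dir :: "real \<Rightarrow> real^2" where
  "axis_dir \<theta> = vector [cos \<theta>, sin \<theta>]"

definition normal_dir :: "real \<Rightarrow> real^2" where
  "normal_dir \<theta> = vector [- sin \<theta>, cos \<theta>]"

lemma dir_nth [simp]:
  "axis_dir \<theta> $ 1 = cos \<theta>" "axis_dir \<theta> $ 2 = sin \<theta>"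
  "normal_dir \<theta> $ 1 = - sin \<theta>" "normal_dir \<theta> $ 2 = cos \<theta>"
  by (simp_all add: axis_dir_def normal_dir_def vector_2)

lemma inner_dir [simp]:
  "axis_dir \<theta> \<bullet> axis_dir \<theta> = 1" "normal_dir \<theta> \<bullet> normal_dir \<theta> = 1"
  "axis_dir \<theta> \<bullet> normal_dir \<theta> = 0" "normal_dir \<theta> \<bullet> axis_dir \<theta> = 0"
  by (simp_all add: inner_real2 flip: power2_eq_square)

lemma norm_dir [simp]: "norm (axis_dir \<theta>) = 1" "norm (normal_dir \<theta>) = 1"
  by (simp_all add: norm_eq_1)

lemma frame_decomposition:
  "x = (axis_dir \<theta> \<bullet> x) *\<^sub>R axis_dir \<theta> + (normal_dir \<theta> \<bullet> x) *\<^sub>R normal_dir \<theta>"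
proof -
  have 1: "sin \<theta> * sin \<theta> = 1 - cos \<theta> * cos \<theta>"
    using sin_cos_squared_add[of \<theta>] by (simp add: power2_eq_square)
  have "x$1 = (cos \<theta> * x$1 + sin \<theta> * x$2) * cos \<theta> + (- sin \<theta> * x$1 + cos \<theta> * x$2) * (- sin \<theta>)"
    "x$2 = (cos \<theta> * x$1 + sin \<theta> * x$2) * sin \<theta> + (- sin \<theta> * x$1 + cos \<theta> * x$2) * cos \<theta>"
    using 1 by algebra+
  then show ?thesis by (simp add: vec_eq_iff forall_2 inner_real2)
qed

lemma frame_eqI:
  assumes "axis_dir \<theta> \<bullet> x = axis_dir \<theta> \<bullet> y" "normal_dir \<theta> \<bullet> x = normal_dir \<theta> \<bullet> y"
  shows "x = y"
  using frame_decomposition[of x \<theta>] frame_decomposition[of y \<theta>] assms by simp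

text \<open>Supporting lines at \<open>tp\<close> and \<open>bt\<close> that are not parallel to the chord between these points keep the
convex set from extending beyond them on the line of the chord.\<close>

lemma chord_of_convex:
  assumes cvx: "convex E" and tb: "tp \<in> E" "bt \<in> E"
    and u: "axis_dir \<theta> \<bullet> tp = axis_dir \<theta> \<bullet> y" and l: "tp - bt = l *\<^sub>R normal_dir \<theta>" "0 \<le> l"
    and g: "g \<bullet> normal_dir \<theta> > 0" "\<And>x. x \<in> E \<Longrightarrow> g \<bullet> x \<le> g \<bullet> tp"
    and h: "h \<bullet> normal_dir \<theta> > 0" "\<And>x. x \<in> E \<Longrightarrow> h \<bullet> bt \<le> h \<bullet> x"
  shows "\<exists>lo hi. lo \<le> hi \<and> hi - lo = l \<and> y + hi *\<^sub>R normal_dir \<theta> = tp \<and> y + lo *\<^sub>R normal_dir \<theta> = bt \<and>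
    (\<forall>r. y + r *\<^sub>R normal_dir \<theta> \<in> E \<longleftrightarrow> lo \<le> r \<and> r \<le> hi)"
proof -
  let ?v = "normal_dir \<theta>"
  define hi where "hi = ?v \<bullet> (tp - y)"
  define lo where "lo = hi - l"
  have tp: "y + hi *\<^sub>R ?v = tp"
    by (rule frame_eqI[of \<theta>]) (simp_all add: inner_add_right hi_def inner_diff_right u)
  have bt: "y + lo *\<^sub>R ?v = bt" using tp l(1) by (simp add: lo_def algebra_simps)
  have sec: "y + r *\<^sub>R ?v \<in> E \<longleftrightarrow> lo \<le> r \<and> r \<le> hi" for r
  proof
    assume r: "y + r *\<^sub>R ?v \<in> E"
    have "(r - hi) * (g \<bullet> ?v) \<le> 0"
      using g(2)[OF r] by (simp add: tp[symmetric] inner_add_right algebra_simps)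
    moreover have "0 \<le> (r - lo) * (h \<bullet> ?v)"
      using h(2)[OF r] by (simp add: bt[symmetric] inner_add_right algebra_simps)
    ultimately show "lo \<le> r \<and> r \<le> hi" using g(1) h(1) by (simp add: mult_le_0_iff zero_le_mult_iff)
  next
    assume r: "lo \<le> r \<and> r \<le> hi"
    show "y + r *\<^sub>R ?v \<in> E"
    proof (cases "l = 0")
      case True
      then have "r = hi" using r by (simp add: lo_def)
      then show ?thesis using tp tb by simp
    next
      case False
      define \<mu> where "\<mu> = (r - lo) / l"
      have \<mu>: "0 \<le> \<mu>" "\<mu> \<le> 1" "\<mu> * l = r - lo"
        using r False l(2) by (auto simp: \<mu>_def lo_def field_simps)
      have "y + r *\<^sub>R ?v = (1 - \<mu>) *\<^sub>R bt + \<mu> *\<^sub>R tp"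
      proof -
        have "(1 - \<mu>) *\<^sub>R bt + \<mu> *\<^sub>R tp = bt + \<mu> *\<^sub>R (tp - bt)" by (simp add: algebra_simps)
        also have "\<dots> = y + lo *\<^sub>R ?v + (r - lo) *\<^sub>R ?v" by (simp add: l bt \<mu>)
        finally show ?thesis by (simp add: algebra_simps)
      qed
      then show ?thesis using convexD[OF cvx tb(2,1), of "1 - \<mu>" \<mu>] \<mu> by simp
    qed
  qed
  have "lo \<le> hi" "hi - lo = l" using l(2) by (simp_all add: lo_def)
  then show ?thesis using tp bt sec by blast
qed

text \<open>The length of the chord at distance \<open>s\<close> from the center, for a hexagon whose parallel short diagonals
have length \<open>w\<close> and distance \<open>a\<close> from the center and whose remaining vertices have distance \<open>X\<close>.\<close>

definition chord_length :: "real \<Rightarrow> real \<Rightarrow> real \<Rightarrow> real \<Rightarrow> real" where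
  "chord_length X a w s = (if \<bar>s\<bar> \<le> a then w else w * (X - \<bar>s\<bar>) / (X - a))"

text \<open>A chord in the direction of \<open>q + r\<close> joins points of two opposite sides if it is between the diagonals,
and points of the two sides meeting at \<open>p\<close> or at \<open>-p\<close> otherwise. In the first case both ends are
supported by \<open>\<beta>\<close>, in the other cases one end is supported by \<open>\<alpha>\<close> and the other by \<open>\<gamma>\<close>.\<close>

lemma hexagon_sections:
  assumes hex: "hexagonal E c p q r" and w: "q + r = w *\<^sub>R normal_dir \<theta>" "w > 0"
  defines "X \<equiv> \<bar>axis_dir \<theta> \<bullet> p\<bar>" and "a \<equiv> \<bar>axis_dir \<theta> \<bullet> r\<bar>"
  shows "0 < a" "a < X"
    "X < \<bar>axis_dir \<theta> \<bullet> (y - c)\<bar> \<Longrightarrow> y + t *\<^sub>R normal_dir \<theta> \<notin> E"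
    "\<bar>axis_dir \<theta> \<bullet> (y - c)\<bar> \<le> X \<Longrightarrow> \<exists>lo hi. lo \<le> hi \<and> hi - lo = chord_length X a w (axis_dir \<theta> \<bullet> (y - c)) \<and>
      {y + hi *\<^sub>R normal_dir \<theta>, y + lo *\<^sub>R normal_dir \<theta>} \<subseteq> convex hull {c + p, c - p, c + q, c - q, c + r, c - r} \<and>
      (\<forall>r. y + r *\<^sub>R normal_dir \<theta> \<in> E \<longleftrightarrow> lo \<le> r \<and> r \<le> hi)"
proof -
  let ?u = "axis_dir \<theta>" and ?v = "normal_dir \<theta>"
  let ?V = "{c + p, c - p, c + q, c - q, c + r, c - r}"
  obtain \<alpha> \<beta> \<gamma> where bd: "\<And>x. x \<in> E \<Longrightarrow> \<bar>\<alpha> \<bullet> (x - c)\<bar> \<le> 1 \<and> \<bar>\<beta> \<bullet> (x - c)\<bar> \<le> 1 \<and> \<bar>\<gamma> \<bullet> (x - c)\<bar> \<le> 1"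
    and vals: "\<alpha> \<bullet> p = 1" "\<alpha> \<bullet> q = 1" "\<beta> \<bullet> q = 1" "\<beta> \<bullet> r = 1" "\<gamma> \<bullet> r = 1" "\<gamma> \<bullet> p = -1"
      "\<alpha> \<bullet> r > -1" "\<gamma> \<bullet> q > -1" and cvx: "convex E" and "q \<noteq> r" and VE: "?V \<subseteq> E"
    using hex unfolding hexagonal_def by auto
  have ab: "\<And>x. x \<in> E \<Longrightarrow> \<bar>\<alpha> \<bullet> (x - c)\<bar> \<le> 1" "\<And>x. x \<in> E \<Longrightarrow> \<bar>\<beta> \<bullet> (x - c)\<bar> \<le> 1"
    "\<And>x. x \<in> E \<Longrightarrow> \<bar>\<gamma> \<bullet> (x - c)\<bar> \<le> 1" using bd by auto
  define \<rho> where "\<rho> = \<alpha> \<bullet> r"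
  define \<tau> where "\<tau> = \<gamma> \<bullet> q"
  have \<rho>: "-1 < \<rho>" "\<rho> \<le> 1" using vals ab(1)[of "c + r"] VE by (auto simp: \<rho>_def)
  have \<tau>: "-1 < \<tau>" "\<tau> \<le> 1" using vals ab(3)[of "c + q"] VE by (auto simp: \<tau>_def)
  have gv: "w * (g \<bullet> ?v) = g \<bullet> q + g \<bullet> r" for g
    using arg_cong[OF w(1), of "\<lambda>x. g \<bullet> x"] by (simp add: inner_add_right)
  have \<alpha>v: "w * (\<alpha> \<bullet> ?v) = 1 + \<rho>" and \<beta>v: "w * (\<beta> \<bullet> ?v) = 2" and \<gamma>v: "w * (\<gamma> \<bullet> ?v) = 1 + \<tau>"
    using gv vals by (simp_all add: \<rho>_def \<tau>_def)
  have pos: "\<alpha> \<bullet> ?v > 0" "\<beta> \<bullet> ?v > 0" "\<gamma> \<bullet> ?v > 0"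
    by (rule zero_less_mult_pos[OF _ w(2)], use \<alpha>v \<beta>v \<gamma>v \<rho> \<tau> in simp)+
  have uqr: "?u \<bullet> q = - (?u \<bullet> r)"
    using arg_cong[OF w(1), of "\<lambda>x. ?u \<bullet> x"] by (simp add: inner_add_right)
  \<comment> \<open>This combination of the functionals of the sides meeting at \<open>p\<close> vanishes on \<open>q + r\<close>, so it is a
    multiple \<open>k\<close> of the coordinate along the axis; its extremal value is attained at \<open>p\<close>.\<close>
  define \<sigma> where "\<sigma> = (1 + \<tau>) *\<^sub>R \<alpha> - (1 + \<rho>) *\<^sub>R \<gamma>"
  define k where "k = \<sigma> \<bullet> ?u"
  have "w * (\<sigma> \<bullet> ?v) = (1 + \<tau>) * (w * (\<alpha> \<bullet> ?v)) - (1 + \<rho>) * (w * (\<gamma> \<bullet> ?v))"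
    by (simp add: \<sigma>_def inner_diff_left algebra_simps)
  then have \<sigma>v: "\<sigma> \<bullet> ?v = 0" using w(2) by (simp add: \<alpha>v \<gamma>v)
  have \<sigma>x: "\<sigma> \<bullet> x = k * (?u \<bullet> x)" for x
  proof -
    have "\<sigma> \<bullet> x = \<sigma> \<bullet> ((?u \<bullet> x) *\<^sub>R ?u + (?v \<bullet> x) *\<^sub>R ?v)" using frame_decomposition[of x \<theta>] by simp
    then show ?thesis using \<sigma>v by (simp add: inner_add_right k_def)
  qed
  have kp: "k * (?u \<bullet> p) = 2 + \<rho> + \<tau>" and kq: "k * (?u \<bullet> q) = 1 - \<rho> * \<tau>"
    using vals by (simp_all add: \<sigma>x[symmetric] \<sigma>_def inner_diff_left \<rho>_def[symmetric] \<tau>_def[symmetric] algebra_simps)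
  have "1 - \<rho> * \<tau> \<noteq> 0"
  proof
    assume "1 - \<rho> * \<tau> = 0"
    moreover have "k \<noteq> 0" using kp \<rho> \<tau> by auto
    ultimately have "?u \<bullet> q = 0" using kq by simp
    then have "?u \<bullet> q = ?u \<bullet> r" using uqr by simp
    moreover have "?v \<bullet> q = ?v \<bullet> r"
    proof -
      have "\<beta> \<bullet> q = (?v \<bullet> q) * (\<beta> \<bullet> ?v)" "\<beta> \<bullet> r = (?v \<bullet> r) * (\<beta> \<bullet> ?v)"
        using \<open>?u \<bullet> q = 0\<close> uqr frame_decomposition[of q \<theta>] frame_decomposition[of r \<theta>]
        by (metis add_0 inner_scaleR_right scaleR_zero_left neg_equal_0_iff_equal)+
      then show ?thesis using vals pos by (metis mult_right_cancel less_irrefl)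
    qed
    ultimately show False using \<open>q \<noteq> r\<close> frame_eqI by metis
  qed
  moreover have "\<rho> * \<tau> \<le> 1"
  proof -
    have "\<bar>\<rho>\<bar> * \<bar>\<tau>\<bar> \<le> 1 * 1" using \<rho> \<tau> by (intro mult_mono) auto
    then show ?thesis by (simp flip: abs_mult)
  qed
  ultimately have kq_pos: "0 < k * (?u \<bullet> q)" using kq by simp
  have kpq: "k * (?u \<bullet> q) < k * (?u \<bullet> p)"
  proof -
    have "0 < (1 + \<rho>) * (1 + \<tau>)" using \<rho> \<tau> by simp
    then show ?thesis using kp kq by (simp add: algebra_simps)
  qed
  have k0: "k \<noteq> 0" using kq_pos by auto
  \<comment> \<open>The sign accounts for the orientation of the vertices: \<open>p\<close> and \<open>q\<close> are on the side of \<open>\<epsilon>\<close> on the axis.\<close>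
  define \<epsilon> where "\<epsilon> = sgn k"
  have \<epsilon>: "\<epsilon> * \<epsilon> = 1" "k = \<epsilon> * \<bar>k\<bar>" "\<bar>\<epsilon>\<bar> = 1" using k0 by (auto simp: \<epsilon>_def sgn_if)
  have up: "\<epsilon> * (?u \<bullet> p) = X" and uq: "\<epsilon> * (?u \<bullet> q) = a" and ur: "\<epsilon> * (?u \<bullet> r) = - a" and aX: "0 < a" "a < X"
  proof -
    have 1: "\<bar>k\<bar> * (\<epsilon> * (?u \<bullet> x)) = k * (?u \<bullet> x)" for x using \<epsilon>(2) by (metis mult.assoc mult.commute)
    have "0 < \<epsilon> * (?u \<bullet> q)" using kq_pos 1[of q] k0 by (metis zero_less_mult_pos zero_less_abs_iff)
    moreover have "\<epsilon> * (?u \<bullet> q) < \<epsilon> * (?u \<bullet> p)"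
      using kpq 1[of q] 1[of p] k0 by (metis mult_less_cancel_left_pos zero_less_abs_iff)
    moreover have "\<bar>\<epsilon> * (?u \<bullet> p)\<bar> = X" "\<bar>\<epsilon> * (?u \<bullet> q)\<bar> = a"
      using \<epsilon>(3) uqr by (simp_all add: abs_mult X_def a_def)
    ultimately show "\<epsilon> * (?u \<bullet> p) = X" "\<epsilon> * (?u \<bullet> q) = a" "0 < a" "a < X" by auto
    then show "\<epsilon> * (?u \<bullet> r) = - a" using uqr by simp
  qed
  show "0 < a" "a < X" by fact+
  define s where "s = \<epsilon> * (?u \<bullet> (y - c))"
  have abs_s: "\<bar>?u \<bullet> (y - c)\<bar> = \<bar>s\<bar>" using \<epsilon>(3) by (simp add: s_def abs_mult)
  have us: "?u \<bullet> x = ?u \<bullet> y" if "\<epsilon> * (?u \<bullet> (x - c)) = s" for x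
  proof -
    have "\<epsilon> * (\<epsilon> * (?u \<bullet> (x - c))) = \<epsilon> * (\<epsilon> * (?u \<bullet> (y - c)))" using that by (simp add: s_def)
    then show ?thesis using \<epsilon>(1) by (simp add: inner_diff_right flip: mult.assoc)
  qed
  show "y + t *\<^sub>R ?v \<notin> E" if out: "X < \<bar>?u \<bullet> (y - c)\<bar>"
  proof
    assume "y + t *\<^sub>R ?v \<in> E"
    then have "\<bar>\<alpha> \<bullet> (y + t *\<^sub>R ?v - c)\<bar> \<le> 1" "\<bar>\<gamma> \<bullet> (y + t *\<^sub>R ?v - c)\<bar> \<le> 1" using ab by auto
    then have "(1 + \<tau>) * \<bar>\<alpha> \<bullet> (y + t *\<^sub>R ?v - c)\<bar> \<le> 1 + \<tau>" "(1 + \<rho>) * \<bar>\<gamma> \<bullet> (y + t *\<^sub>R ?v - c)\<bar> \<le> 1 + \<rho>"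
      using \<rho> \<tau> by (simp_all add: mult_left_le)
    moreover have "\<bar>\<sigma> \<bullet> (y + t *\<^sub>R ?v - c)\<bar> \<le>
        (1 + \<tau>) * \<bar>\<alpha> \<bullet> (y + t *\<^sub>R ?v - c)\<bar> + (1 + \<rho>) * \<bar>\<gamma> \<bullet> (y + t *\<^sub>R ?v - c)\<bar>"
      using abs_triangle_ineq4[of "(1 + \<tau>) * (\<alpha> \<bullet> (y + t *\<^sub>R ?v - c))" "(1 + \<rho>) * (\<gamma> \<bullet> (y + t *\<^sub>R ?v - c))"] \<rho> \<tau>
      by (simp add: \<sigma>_def inner_diff_left abs_mult)
    ultimately have "\<bar>\<sigma> \<bullet> (y + t *\<^sub>R ?v - c)\<bar> \<le> 2 + \<rho> + \<tau>" by linarith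
    also have "\<dots> = \<bar>k\<bar> * X" using kp up \<epsilon>(1,2) by (metis mult.assoc mult.commute)
    also have "\<sigma> \<bullet> (y + t *\<^sub>R ?v - c) = k * (?u \<bullet> (y - c))"
      by (simp add: \<sigma>x inner_add_right inner_diff_right algebra_simps)
    finally show False using out k0 by (simp add: abs_mult)
  qed
  assume inside: "\<bar>?u \<bullet> (y - c)\<bar> \<le> X"
  have comb: "\<mu> *\<^sub>R x + \<nu> *\<^sub>R x' \<in> convex hull ?V" if "x \<in> ?V" "x' \<in> ?V" "0 \<le> \<mu>" "0 \<le> \<nu>" "\<mu> + \<nu> = 1" for x x' \<mu> \<nu>
    using that by (intro convexD[OF convex_convex_hull]) (auto intro: hull_inc)
  have HE: "convex hull ?V \<subseteq> E" using VE cvx by (rule hull_minimal)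
  \<comment> \<open>The chord between the point dividing the side \<open>x1 x2\<close> and the point dividing the side \<open>z1 z2\<close> in the
same ratio.\<close>
  have sec: "\<exists>lo hi. lo \<le> hi \<and> hi - lo = chord_length X a w (?u \<bullet> (y - c)) \<and>
      {y + hi *\<^sub>R ?v, y + lo *\<^sub>R ?v} \<subseteq> convex hull ?V \<and>
      (\<forall>r. y + r *\<^sub>R ?v \<in> E \<longleftrightarrow> lo \<le> r \<and> r \<le> hi)"
    if \<mu>\<nu>: "0 \<le> \<mu>" "0 \<le> \<nu>" "\<mu> + \<nu> = 1" and V: "c + x1 \<in> ?V" "c + x2 \<in> ?V" "c + z1 \<in> ?V" "c + z2 \<in> ?V"
      and u: "\<epsilon> * (\<mu> * (?u \<bullet> x1) + \<nu> * (?u \<bullet> x2)) = s"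
      and l: "\<mu> *\<^sub>R (x1 - z1) + \<nu> *\<^sub>R (x2 - z2) = l *\<^sub>R ?v" "l = chord_length X a w s" "0 \<le> l"
      and g: "g \<in> {\<alpha>, \<beta>, \<gamma>}" "g \<bullet> x1 = 1" "g \<bullet> x2 = 1" and h: "h \<in> {\<alpha>, \<beta>, \<gamma>}" "h \<bullet> z1 = -1" "h \<bullet> z2 = -1"
    for \<mu> \<nu> x1 x2 z1 z2 l g h
  proof -
    define tp where "tp = \<mu> *\<^sub>R (c + x1) + \<nu> *\<^sub>R (c + x2)"
    define bt where "bt = \<mu> *\<^sub>R (c + z1) + \<nu> *\<^sub>R (c + z2)"
    have hull: "tp \<in> convex hull ?V" "bt \<in> convex hull ?V"
      unfolding tp_def bt_def using V \<mu>\<nu> by (auto intro!: comb simp del: insert_iff)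
    have c1: "\<mu> *\<^sub>R c + \<nu> *\<^sub>R c = c" using \<mu>\<nu>(3) by (metis scaleR_add_left scaleR_one)
    have tp: "tp = c + (\<mu> *\<^sub>R x1 + \<nu> *\<^sub>R x2)" "bt = c + (\<mu> *\<^sub>R z1 + \<nu> *\<^sub>R z2)"
      using c1 by (simp_all add: tp_def bt_def scaleR_add_right algebra_simps)
    have gt: "g \<bullet> (tp - c) = 1" "h \<bullet> (bt - c) = -1"
      using g h \<mu>\<nu>(3) by (simp_all add: tp inner_add_right)
    have gpos: "g \<bullet> ?v > 0" "h \<bullet> ?v > 0" using g(1) h(1) pos by auto
    have gle: "g \<bullet> x \<le> g \<bullet> tp" if "x \<in> E" for x
    proof -
      have "g \<bullet> (x - c) \<le> 1" using g(1) ab[OF that] by (auto simp: abs_le_iff)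
      then show ?thesis using gt by (simp add: inner_diff_right)
    qed
    have hle: "h \<bullet> bt \<le> h \<bullet> x" if "x \<in> E" for x
    proof -
      have "- 1 \<le> h \<bullet> (x - c)" using h(1) ab[OF that] by (auto simp: abs_le_iff)
      then show ?thesis using gt by (simp add: inner_diff_right)
    qed
    have "?u \<bullet> tp = ?u \<bullet> y" by (rule us) (simp add: tp inner_add_right u)
    moreover have "tp - bt = l *\<^sub>R ?v"
      unfolding l(1)[symmetric] tp by (simp add: algebra_simps)
    ultimately obtain lo hi where lh: "lo \<le> hi" "hi - lo = l" "y + hi *\<^sub>R ?v = tp" "y + lo *\<^sub>R ?v = bt"
      "\<forall>r. y + r *\<^sub>R ?v \<in> E \<longleftrightarrow> lo \<le> r \<and> r \<le> hi"
      using chord_of_convex[OF cvx subsetD[OF HE hull(1)] subsetD[OF HE hull(2)] _ _ l(3) gpos(1) gle gpos(2) hle] by blast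
    have "chord_length X a w (?u \<bullet> (y - c)) = l"
      using abs_s l(2) by (simp add: chord_length_def)
    then have "hi - lo = chord_length X a w (?u \<bullet> (y - c))" using lh(2) by simp
    moreover have "{y + hi *\<^sub>R ?v, y + lo *\<^sub>R ?v} \<subseteq> convex hull ?V"
      unfolding lh(3,4) using hull by blast
    ultimately show ?thesis using lh(1,5) by blast
  qed
  have s: "\<bar>s\<bar> \<le> X" using inside abs_s by simp
  consider (mid) "\<bar>s\<bar> \<le> a" | (left) "s > a" | (right) "s < - a" by linarith
  then show "\<exists>lo hi. lo \<le> hi \<and> hi - lo = chord_length X a w (?u \<bullet> (y - c)) \<and>
      {y + hi *\<^sub>R ?v, y + lo *\<^sub>R ?v} \<subseteq> convex hull ?V \<and>
      (\<forall>r. y + r *\<^sub>R ?v \<in> E \<longleftrightarrow> lo \<le> r \<and> r \<le> hi)"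
  proof cases
    case mid
    define \<mu> where "\<mu> = (a + s) / (2 * a)"
    have \<mu>: "0 \<le> \<mu>" "0 \<le> 1 - \<mu>" "\<mu> + (1 - \<mu>) = 1" using mid aX by (auto simp: \<mu>_def field_simps)
    show ?thesis
    proof (rule sec[OF \<mu>, of q r "- r" "- q" w \<beta> \<beta>])
      have "\<epsilon> * (\<mu> * (?u \<bullet> q) + (1 - \<mu>) * (?u \<bullet> r)) = \<mu> * (\<epsilon> * (?u \<bullet> q)) + (1 - \<mu>) * (\<epsilon> * (?u \<bullet> r))"
        by (simp add: algebra_simps)
      also have "\<dots> = s" using aX by (simp add: uq ur \<mu>_def field_simps)
      finally show "\<epsilon> * (\<mu> * (?u \<bullet> q) + (1 - \<mu>) * (?u \<bullet> r)) = s" .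
      show "\<mu> *\<^sub>R (q - - r) + (1 - \<mu>) *\<^sub>R (r - - q) = w *\<^sub>R ?v"
        unfolding w(1)[symmetric] by (simp add: algebra_simps)
    qed (use mid w vals in \<open>auto simp: chord_length_def\<close>)
  next
    case left
    define \<mu> where "\<mu> = (s - a) / (X - a)"
    have \<mu>: "0 \<le> \<mu>" "0 \<le> 1 - \<mu>" "\<mu> + (1 - \<mu>) = 1" using left s aX by (simp_all add: \<mu>_def)
    have l: "1 - \<mu> = (X - s) / (X - a)"
      using diff_divide_distrib[of "X - a" "s - a" "X - a"] aX by (simp add: \<mu>_def)
    show ?thesis
    proof (rule sec[OF \<mu>, of p q p "- r" "(1 - \<mu>) * w" \<alpha> \<gamma>])
      have "\<epsilon> * (\<mu> * (?u \<bullet> p) + (1 - \<mu>) * (?u \<bullet> q)) = \<mu> * (\<epsilon> * (?u \<bullet> p)) + (1 - \<mu>) * (\<epsilon> * (?u \<bullet> q))"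
        by (simp add: algebra_simps)
      also have "\<dots> = a + \<mu> * (X - a)" by (simp add: up uq algebra_simps)
      also have "\<dots> = s" using aX by (simp add: \<mu>_def)
      finally show "\<epsilon> * (\<mu> * (?u \<bullet> p) + (1 - \<mu>) * (?u \<bullet> q)) = s" .
      show "\<mu> *\<^sub>R (p - p) + (1 - \<mu>) *\<^sub>R (q - - r) = ((1 - \<mu>) * w) *\<^sub>R ?v"
        by (simp add: w(1))
      show "(1 - \<mu>) * w = chord_length X a w s" using left aX by (simp add: chord_length_def l)
    qed (use w vals \<mu> in auto)
  next
    case right
    define \<mu> where "\<mu> = (- s - a) / (X - a)"
    have \<mu>: "0 \<le> \<mu>" "0 \<le> 1 - \<mu>" "\<mu> + (1 - \<mu>) = 1" using right s aX by (simp_all add: \<mu>_def)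
    have l: "1 - \<mu> = (X + s) / (X - a)"
      using diff_divide_distrib[of "X - a" "- s - a" "X - a"] aX by (simp add: \<mu>_def)
    show ?thesis
    proof (rule sec[OF \<mu>, of "- p" r "- p" "- q" "(1 - \<mu>) * w" \<gamma> \<alpha>])
      have "\<epsilon> * (\<mu> * (?u \<bullet> - p) + (1 - \<mu>) * (?u \<bullet> r)) = - (\<mu> * (\<epsilon> * (?u \<bullet> p))) + (1 - \<mu>) * (\<epsilon> * (?u \<bullet> r))"
        by (simp add: algebra_simps)
      also have "\<dots> = - a - \<mu> * (X - a)" by (simp add: up ur algebra_simps)
      also have "\<dots> = s" using aX by (simp add: \<mu>_def)
      finally show "\<epsilon> * (\<mu> * (?u \<bullet> - p) + (1 - \<mu>) * (?u \<bullet> r)) = s" .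
      show "\<mu> *\<^sub>R (- p - - p) + (1 - \<mu>) *\<^sub>R (r - - q) = ((1 - \<mu>) * w) *\<^sub>R ?v"
        using w(1) by (simp add: add.commute)
      show "(1 - \<mu>) * w = chord_length X a w s" using right aX by (simp add: chord_length_def l)
    qed (use w vals \<mu> in auto)
  qed
qed

text \<open>Every point lies on a chord whose ends are on sides between the six vertices.\<close>

lemma hexagonal_eq_hull:
  assumes hex: "hexagonal E c p q r" and w: "q + r = w *\<^sub>R normal_dir \<theta>" "w > 0"
  shows "E = convex hull {c + p, c - p, c + q, c - q, c + r, c - r}" (is "E = convex hull ?V")
proof
  show "convex hull ?V \<subseteq> E" using hex unfolding hexagonal_def by (intro hull_minimal) auto
  show "E \<subseteq> convex hull ?V"
  proof
    fix y assume y: "y \<in> E"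
    then have "y + 0 *\<^sub>R normal_dir \<theta> \<in> E" by simp
    then have "\<bar>axis_dir \<theta> \<bullet> (y - c)\<bar> \<le> \<bar>axis_dir \<theta> \<bullet> p\<bar>"
      using hexagon_sections(3)[OF hex w] by (metis not_less)
    then obtain lo hi where lh: "{y + hi *\<^sub>R normal_dir \<theta>, y + lo *\<^sub>R normal_dir \<theta>} \<subseteq> convex hull ?V"
      "\<forall>r. y + r *\<^sub>R normal_dir \<theta> \<in> E \<longleftrightarrow> lo \<le> r \<and> r \<le> hi"
      using hexagon_sections(4)[OF hex w] by blast
    have 0: "lo \<le> 0" "0 \<le> hi" using lh(2)[rule_format, of 0] y by auto
    show "y \<in> convex hull ?V"
    proof (cases "lo = hi")
      case True
      then show ?thesis using lh(1) 0 by simp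
    next
      case False
      define \<mu> where "\<mu> = - lo / (hi - lo)"
      have \<mu>: "0 \<le> \<mu>" "0 \<le> 1 - \<mu>" "\<mu> * hi + (1 - \<mu>) * lo = 0"
        using 0 False by (auto simp: \<mu>_def field_simps)
      have "\<mu> *\<^sub>R (y + hi *\<^sub>R normal_dir \<theta>) + (1 - \<mu>) *\<^sub>R (y + lo *\<^sub>R normal_dir \<theta>)
          = y + (\<mu> * hi + (1 - \<mu>) * lo) *\<^sub>R normal_dir \<theta>"
        by (simp add: algebra_simps)
      also have "\<dots> = y" using \<mu> by simp
      finally show ?thesis
        using convexD[OF convex_convex_hull, of "y + hi *\<^sub>R normal_dir \<theta>" ?V "y + lo *\<^sub>R normal_dir \<theta>" \<mu> "1 - \<mu>"] lh(1) \<mu>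
        by simp
    qed
  qed
qed

text \<open>The hexagon with vertices at \<open>\<kappa> \<plusminus> X\<close> on the line through the origin in direction \<open>\<theta>\<close> and with
two diagonals of length \<open>w\<close> perpendicular to it at \<open>\<kappa> \<plusminus> a\<close>. The second inequality bounds the four
slanted sides.\<close>

definition axial_hexagon :: "real \<Rightarrow> real \<Rightarrow> real \<Rightarrow> real \<Rightarrow> real \<Rightarrow> (real^2) set" where
  "axial_hexagon \<theta> \<kappa> X a w = {y. 2 * \<bar>normal_dir \<theta> \<bullet> y\<bar> \<le> w \<and>
     2 * (X - a) * \<bar>normal_dir \<theta> \<bullet> y\<bar> \<le> w * (X - \<bar>axis_dir \<theta> \<bullet> y - \<kappa>\<bar>)}"

text \<open>The inequality \<open>2 * t \<le> chord_length X a w s\<close> is the conjunction of the two inequalities that define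
the axial hexagon: between the diagonals the second one follows from the first, outside them the
first one follows from the second.\<close>

lemma steiner_symmetrization_hexagonal:
  assumes hex: "hexagonal E c p q r" and w: "q + r = w *\<^sub>R normal_dir \<theta>" "w > 0"
  defines "X \<equiv> \<bar>axis_dir \<theta> \<bullet> p\<bar>" and "a \<equiv> \<bar>axis_dir \<theta> \<bullet> r\<bar>"
  shows "steiner_symmetrization {x. normal_dir \<theta> \<bullet> x = 0} E = axial_hexagon \<theta> (axis_dir \<theta> \<bullet> c) X a w"
proof (intro set_eqI)
  fix y
  have aX: "0 < a" "a < X" using hexagon_sections(1,2)[OF hex w] by (simp_all add: X_def a_def)
  define s where "s = axis_dir \<theta> \<bullet> (y - c)"
  define t where "t = \<bar>normal_dir \<theta> \<bullet> y\<bar>"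
  have t: "0 \<le> t" by (simp add: t_def)
  have mem: "y \<in> axial_hexagon \<theta> (axis_dir \<theta> \<bullet> c) X a w \<longleftrightarrow> 2 * t \<le> w \<and> 2 * (X - a) * t \<le> w * (X - \<bar>s\<bar>)"
    by (simp add: axial_hexagon_def s_def t_def inner_diff_right)
  show "y \<in> steiner_symmetrization {x. normal_dir \<theta> \<bullet> x = 0} E \<longleftrightarrow> y \<in> axial_hexagon \<theta> (axis_dir \<theta> \<bullet> c) X a w"
  proof (cases "\<bar>s\<bar> \<le> X")
    case False
    then have "{y + r *\<^sub>R normal_dir \<theta> | r. True} \<inter> E = {}"
      using hexagon_sections(3)[OF hex w, of y] by (auto simp: s_def X_def)
    then have "y \<notin> steiner_symmetrization {x. normal_dir \<theta> \<bullet> x = 0} E"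
      using mem_steiner_symmetrization_iff[of "normal_dir \<theta>" y E] by simp
    moreover have "w * (X - \<bar>s\<bar>) < 0" using False w(2) by (simp add: mult_pos_neg)
    moreover have "0 \<le> 2 * (X - a) * t" using aX t by simp
    ultimately show ?thesis using mem by linarith
  next
    case True
    then obtain lo hi where lh: "lo \<le> hi" "hi - lo = chord_length X a w s"
      "\<And>r. y + r *\<^sub>R normal_dir \<theta> \<in> E \<longleftrightarrow> lo \<le> r \<and> r \<le> hi"
      using hexagon_sections(4)[OF hex w, of y] unfolding s_def X_def a_def by blast
    have "y \<in> steiner_symmetrization {x. normal_dir \<theta> \<bullet> x = 0} E \<longleftrightarrow> 2 * t \<le> chord_length X a w s"
      using mem_steiner_symmetrization_segment[OF _ lh(1,3)] lh(2) by (simp add: t_def)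
    also have "\<dots> \<longleftrightarrow> 2 * t \<le> w \<and> 2 * (X - a) * t \<le> w * (X - \<bar>s\<bar>)"
    proof (cases "\<bar>s\<bar> \<le> a")
      case True
      have "2 * (X - a) * t \<le> w * (X - \<bar>s\<bar>)" if "2 * t \<le> w"
      proof -
        have "(X - a) * (2 * t) \<le> (X - \<bar>s\<bar>) * w" using that True aX t by (intro mult_mono) auto
        then show ?thesis by (simp add: mult_ac)
      qed
      then show ?thesis using True by (auto simp: chord_length_def)
    next
      case s: False
      have "2 * t \<le> w" if "2 * (X - a) * t \<le> w * (X - \<bar>s\<bar>)"
      proof -
        have "w * (X - \<bar>s\<bar>) \<le> w * (X - a)" using s w(2) by (intro mult_left_mono) auto
        then have "(2 * t) * (X - a) \<le> w * (X - a)" using that by (simp add: mult_ac)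
        then show ?thesis using aX by simp
      qed
      moreover have "2 * t \<le> chord_length X a w s \<longleftrightarrow> 2 * (X - a) * t \<le> w * (X - \<bar>s\<bar>)"
        using s aX by (simp add: chord_length_def pos_le_divide_eq mult_ac)
      ultimately show ?thesis by blast
    qed
    finally show ?thesis using mem by simp
  qed
qed

section \<open>Hexagons with an axis of symmetry\<close>

lemma convex_axial_hexagon:
  assumes "a < X" "0 < w"
  shows "convex (axial_hexagon \<theta> \<kappa> X a w)"
proof (rule convexI)
  fix x y :: "real^2" and \<mu> \<nu> :: real
  assume x: "x \<in> axial_hexagon \<theta> \<kappa> X a w" and y: "y \<in> axial_hexagon \<theta> \<kappa> X a w"
    and \<mu>: "0 \<le> \<mu>" "0 \<le> \<nu>" "\<mu> + \<nu> = 1"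
  define t where "t z = \<bar>normal_dir \<theta> \<bullet> z\<bar>" for z
  define s where "s z = \<bar>axis_dir \<theta> \<bullet> z - \<kappa>\<bar>" for z
  let ?z = "\<mu> *\<^sub>R x + \<nu> *\<^sub>R y"
  have mem: "z \<in> axial_hexagon \<theta> \<kappa> X a w \<longleftrightarrow> 2 * t z \<le> w \<and> 2 * (X - a) * t z + w * s z \<le> w * X" for z
    by (auto simp: axial_hexagon_def t_def s_def algebra_simps)
  have t: "t ?z \<le> \<mu> * t x + \<nu> * t y"
    using abs_triangle_ineq[of "\<mu> * (normal_dir \<theta> \<bullet> x)" "\<nu> * (normal_dir \<theta> \<bullet> y)"] \<mu>
    by (simp add: t_def inner_add_right abs_mult)
  have s: "s ?z \<le> \<mu> * s x + \<nu> * s y"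
  proof -
    have "axis_dir \<theta> \<bullet> ?z - \<kappa> = \<mu> * (axis_dir \<theta> \<bullet> x - \<kappa>) + \<nu> * (axis_dir \<theta> \<bullet> y - \<kappa>)"
      using \<mu>(3) by (simp add: inner_add_right algebra_simps) (metis distrib_left mult_1_right)
    then show ?thesis
      using abs_triangle_ineq[of "\<mu> * (axis_dir \<theta> \<bullet> x - \<kappa>)" "\<nu> * (axis_dir \<theta> \<bullet> y - \<kappa>)"] \<mu>
      by (simp add: s_def abs_mult)
  qed
  have "2 * t ?z \<le> \<mu> * (2 * t x) + \<nu> * (2 * t y)" using t by (simp add: algebra_simps)
  also have "\<dots> \<le> \<mu> * w + \<nu> * w" using x y \<mu> by (intro add_mono mult_left_mono) (auto simp: mem)
  also have "\<dots> = w" using \<mu>(3) by (metis distrib_right mult_1)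
  finally have 1: "2 * t ?z \<le> w" .
  have "2 * (X - a) * t ?z + w * s ?z \<le> 2 * (X - a) * (\<mu> * t x + \<nu> * t y) + w * (\<mu> * s x + \<nu> * s y)"
    using assms t s by (intro add_mono mult_left_mono) auto
  also have "\<dots> = \<mu> * (2 * (X - a) * t x + w * s x) + \<nu> * (2 * (X - a) * t y + w * s y)"
    by (simp add: algebra_simps)
  also have "\<dots> \<le> \<mu> * (w * X) + \<nu> * (w * X)" using x y \<mu> by (intro add_mono mult_left_mono) (auto simp: mem)
  also have "\<dots> = w * X" using \<mu>(3) by (metis distrib_right mult_1)
  finally show "?z \<in> axial_hexagon \<theta> \<kappa> X a w" using 1 by (simp add: mem)
qed

text \<open>The vertices are numbered one place further than in the symmetrization that produced the hexagon: the
vertex on the axis is now called \<open>r\<close>, so that \<open>q + r\<close> is the direction of the next short diagonal.\<close>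

lemma hexagonal_axial_hexagon:
  assumes aX: "0 < a" "a < X" and w: "0 < w"
  shows "hexagonal (axial_hexagon \<theta> \<kappa> X a w) (\<kappa> *\<^sub>R axis_dir \<theta>)
    (- a *\<^sub>R axis_dir \<theta> + (w / 2) *\<^sub>R normal_dir \<theta>) (a *\<^sub>R axis_dir \<theta> + (w / 2) *\<^sub>R normal_dir \<theta>) (X *\<^sub>R axis_dir \<theta>)"
  (is "hexagonal ?E ?c ?p ?q ?r")
proof -
  let ?u = "axis_dir \<theta>" and ?v = "normal_dir \<theta>"
  define k where "k = (2 / w) * (1 - a / X)"
  have "1 - a / X > 0" using aX by simp
  then have k: "0 < k" "k * w = 2 * (1 - a / X)" using w unfolding k_def by simp_all
  define \<alpha> where "\<alpha> = (2 / w) *\<^sub>R ?v"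
  define \<beta> where "\<beta> = (1 / X) *\<^sub>R ?u + k *\<^sub>R ?v"
  define \<gamma> where "\<gamma> = (1 / X) *\<^sub>R ?u - k *\<^sub>R ?v"
  have bd: "\<bar>\<alpha> \<bullet> (x - ?c)\<bar> \<le> 1 \<and> \<bar>\<beta> \<bullet> (x - ?c)\<bar> \<le> 1 \<and> \<bar>\<gamma> \<bullet> (x - ?c)\<bar> \<le> 1" if x: "x \<in> ?E" for x
  proof -
    define t where "t = ?v \<bullet> x"
    define s where "s = ?u \<bullet> x - \<kappa>"
    have h: "2 * \<bar>t\<bar> \<le> w" "2 * (X - a) * \<bar>t\<bar> \<le> w * (X - \<bar>s\<bar>)"
      using x by (simp_all add: axial_hexagon_def t_def s_def)
    have v: "\<alpha> \<bullet> (x - ?c) = (2 / w) * t" "\<beta> \<bullet> (x - ?c) = s / X + k * t" "\<gamma> \<bullet> (x - ?c) = s / X - k * t"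
      by (simp_all add: \<alpha>_def \<beta>_def \<gamma>_def s_def t_def inner_add_left inner_diff_left inner_diff_right diff_divide_distrib algebra_simps)
    have "\<bar>s\<bar> / X + k * \<bar>t\<bar> = (w * \<bar>s\<bar> + 2 * (X - a) * \<bar>t\<bar>) / (w * X)"
      using assms by (simp add: k_def field_simps)
    also have "\<dots> \<le> 1" using h(2) assms by (simp add: pos_divide_le_eq algebra_simps)
    finally have "\<bar>s / X\<bar> + \<bar>k * t\<bar> \<le> 1" using assms k by (simp add: abs_mult)
    moreover have "\<bar>(2 / w) * t\<bar> \<le> 1" using h(1) w by (simp add: abs_mult)
    ultimately show ?thesis unfolding v by linarith
  qed
  have X0: "X > 0" using aX by simp
  have "{?c + ?p, ?c - ?p, ?c + ?q, ?c - ?q, ?c + ?r, ?c - ?r} \<subseteq> ?E"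
    using aX w X0 by (auto simp: axial_hexagon_def inner_add_right inner_diff_right algebra_simps)
  moreover have "?q \<noteq> ?r"
  proof
    assume "?q = ?r"
    then have "?v \<bullet> ?q = ?v \<bullet> ?r" by simp
    then show False using w by (simp add: inner_add_right)
  qed
  moreover have "\<alpha> \<bullet> ?p = 1" "\<alpha> \<bullet> ?q = 1" "\<alpha> \<bullet> ?r > -1" "\<beta> \<bullet> ?r = 1" "\<gamma> \<bullet> ?r = 1"
    using w X0 by (simp_all add: \<alpha>_def \<beta>_def \<gamma>_def inner_add_right inner_diff_right inner_diff_left inner_add_left)
  moreover have "\<beta> \<bullet> ?q = 1" "\<gamma> \<bullet> ?p = -1" "\<gamma> \<bullet> ?q > -1"
  proof -
    have "\<beta> \<bullet> ?q = a / X + k * (w / 2)" "\<gamma> \<bullet> ?p = - (a / X) - k * (w / 2)" "\<gamma> \<bullet> ?q = a / X - k * (w / 2)"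
      by (simp_all add: \<beta>_def \<gamma>_def inner_add_right inner_diff_right inner_diff_left inner_add_left)
    moreover have "k * (w / 2) = 1 - a / X" using k(2) by simp
    moreover have "0 < a / X" using aX by simp
    ultimately show "\<beta> \<bullet> ?q = 1" "\<gamma> \<bullet> ?p = -1" "\<gamma> \<bullet> ?q > -1" by linarith+
  qed
  moreover have "\<forall>x\<in>?E. \<bar>\<alpha> \<bullet> (x - ?c)\<bar> \<le> 1 \<and> \<bar>\<beta> \<bullet> (x - ?c)\<bar> \<le> 1 \<and> \<bar>\<gamma> \<bullet> (x - ?c)\<bar> \<le> 1"
    using bd by blast
  moreover have "convex ?E" by (rule convex_axial_hexagon[OF aX(2) w])
  ultimately show ?thesis
    unfolding hexagonal_def
    by (intro conjI exI[of _ \<alpha>] exI[of _ \<beta>] exI[of _ \<gamma>]) assumption+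
qed

lemma dir_rotate:
  "axis_dir (\<theta> + \<phi> - pi / 2) = sin \<phi> *\<^sub>R axis_dir \<theta> - cos \<phi> *\<^sub>R normal_dir \<theta>"
  "normal_dir (\<theta> + \<phi> - pi / 2) = cos \<phi> *\<^sub>R axis_dir \<theta> + sin \<phi> *\<^sub>R normal_dir \<theta>"
  by (simp_all add: vec_eq_iff forall_2 cos_diff sin_diff cos_add sin_add algebra_simps)

text \<open>Polar coordinates of the short diagonal \<open>(a + X, w / 2)\<close> in the frame of the hexagon.\<close>

lemma diagonal_frame:
  assumes "0 < a" "a < X" "0 < w"
  defines "w' \<equiv> sqrt ((a + X)\<^sup>2 + (w / 2)\<^sup>2)" and "\<phi> \<equiv> arctan (w / (2 * (a + X)))"
  shows "w' > 0" "w' * cos \<phi> = a + X" "w' * sin \<phi> = w / 2"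
proof -
  define t where "t = w / (2 * (a + X))"
  have t: "w / 2 = (a + X) * t" using assms by (simp add: t_def field_simps)
  show "w' > 0" using assms by (simp add: w'_def sum_power2_gt_zero_iff)
  have "(a + X)\<^sup>2 + (w / 2)\<^sup>2 = (a + X)\<^sup>2 * (1 + t\<^sup>2)"
    unfolding t by (simp add: power_mult_distrib distrib_left)
  then have w': "w' = (a + X) * sqrt (1 + t\<^sup>2)"
    using assms by (simp add: w'_def real_sqrt_mult)
  have "sqrt (1 + t\<^sup>2) \<noteq> 0" by (simp add: add_nonneg_eq_0_iff)
  then show "w' * cos \<phi> = a + X" "w' * sin \<phi> = w / 2"
    unfolding t w' \<phi>_def t_def[symmetric] cos_arctan sin_arctan by simp_all
qed

text \<open>The new normal direction is that of the diagonal with polar coordinates \<open>w'\<close> and \<open>\<phi>\<close>, so the new axis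
has direction \<open>\<theta> + \<phi> - pi / 2\<close>. The remaining parameters are the projections of the center and of
two consecutive vertices to this axis.\<close>

lemma steiner_symmetrization_axial_hexagon:
  assumes aX: "0 < a" "a < X" and w: "0 < w"
  defines "w' \<equiv> sqrt ((a + X)\<^sup>2 + (w / 2)\<^sup>2)" and "\<phi> \<equiv> arctan (w / (2 * (a + X)))"
  shows "steiner_symmetrization {x. normal_dir (\<theta> + \<phi> - pi / 2) \<bullet> x = 0} (axial_hexagon \<theta> \<kappa> X a w) =
    axial_hexagon (\<theta> + \<phi> - pi / 2) (\<kappa> * w / (2 * w')) (w * (2 * a + X) / (2 * w')) (w * X / (2 * w')) w'"
proof -
  note frame = diagonal_frame[OF aX w, folded w'_def \<phi>_def]
  have cs: "cos \<phi> = (a + X) / w'" "sin \<phi> = w / (2 * w')" using frame by (simp_all add: field_simps)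
  let ?\<theta> = "\<theta> + \<phi> - pi / 2"
  have sum: "(a *\<^sub>R axis_dir \<theta> + (w / 2) *\<^sub>R normal_dir \<theta>) + X *\<^sub>R axis_dir \<theta> = w' *\<^sub>R normal_dir ?\<theta>"
    unfolding dir_rotate scaleR_add_right scaleR_scaleR frame by (simp add: algebra_simps)
  have p: "axis_dir ?\<theta> \<bullet> (- a *\<^sub>R axis_dir \<theta> + (w / 2) *\<^sub>R normal_dir \<theta>) = - (w * (2 * a + X) / (2 * w'))"
    unfolding dir_rotate using frame(1)
    by (simp add: inner_diff_left inner_add_right inner_diff_right cs field_simps)
  have r: "axis_dir ?\<theta> \<bullet> (X *\<^sub>R axis_dir \<theta>) = w * X / (2 * w')"
    and c: "axis_dir ?\<theta> \<bullet> (\<kappa> *\<^sub>R axis_dir \<theta>) = \<kappa> * w / (2 * w')"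
    unfolding dir_rotate by (simp_all add: inner_diff_left cs)
  have "0 \<le> w * (2 * a + X) / (2 * w')" "0 \<le> w * X / (2 * w')" using assms(1-3) frame(1) by simp_all
  note abs = this[THEN abs_of_nonneg]
  show ?thesis
    using steiner_symmetrization_hexagonal[OF hexagonal_axial_hexagon[OF assms(1-3)] sum frame(1), of \<kappa>]
    unfolding p r c abs_minus_cancel abs .
qed

section \<open>Convergence of the shapes\<close>

lemma abs_arctan_diff_le: "\<bar>arctan x - arctan y\<bar> \<le> \<bar>x - y\<bar>"
proof -
  have *: "\<bar>arctan x - arctan y\<bar> \<le> \<bar>x - y\<bar>" if yx: "y < x" for x y :: real
  proof -
    obtain z where "arctan x - arctan y = (x - y) * inverse (1 + z\<^sup>2)"
      using MVT2[OF yx DERIV_arctan] by blast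
    moreover have "0 < inverse (1 + z\<^sup>2)" "inverse (1 + z\<^sup>2) \<le> 1"
      by (simp_all add: add_pos_nonneg inverse_le_1_iff)
    ultimately show ?thesis by (simp add: abs_mult mult_left_le)
  qed
  show ?thesis using *[of x y] *[of y x] by (cases x y rule: linorder_cases) auto
qed

text \<open>The parameters of the axial hexagons that arise by symmetrizing again and again along the next short
diagonal.\<close>

locale hexagon_orbit =
  fixes \<theta> \<kappa> X a w :: "nat \<Rightarrow> real"
  assumes init: "0 < a 0" "a 0 < X 0" "0 < w 0"
    and w_Suc: "\<And>n. w (Suc n) = sqrt ((a n + X n)\<^sup>2 + (w n / 2)\<^sup>2)"
    and X_Suc: "\<And>n. X (Suc n) = w n * (2 * a n + X n) / (2 * w (Suc n))"
    and a_Suc: "\<And>n. a (Suc n) = w n * X n / (2 * w (Suc n))"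
    and \<kappa>_Suc: "\<And>n. \<kappa> (Suc n) = \<kappa> n * w n / (2 * w (Suc n))"
    and \<theta>_Suc: "\<And>n. \<theta> (Suc n) = \<theta> n + arctan (w n / (2 * (a n + X n))) - pi / 2"
begin

lemma positive: "0 < a n" "a n < X n" "0 < w n"
proof -
  have "0 < a n \<and> a n < X n \<and> 0 < w n"
  proof (induction n)
    case 0
    show ?case using init by simp
  next
    case (Suc n)
    have "0 < (a n + X n)\<^sup>2" using Suc by simp
    then have w: "0 < w (Suc n)" by (simp add: w_Suc add_pos_nonneg)
    have "w n * X n < w n * (2 * a n + X n)" using Suc by simp
    then show ?case using Suc w by (simp add: a_Suc X_Suc divide_strict_right_mono)
  qed
  then show "0 < a n" "a n < X n" "0 < w n" by simp_all
qed

text \<open>The common area of all hexagons of the orbit.\<close>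

definition "area = (a 0 + X 0) * w 0"

lemma area_eq: "(a n + X n) * w n = area"
proof (induction n)
  case (Suc n)
  have "(a (Suc n) + X (Suc n)) * w (Suc n) = w n * X n / 2 + w n * (2 * a n + X n) / 2"
    using positive(3)[of "Suc n"] by (simp add: a_Suc X_Suc distrib_right)
  also have "\<dots> = (a n + X n) * w n" by (simp add: field_simps)
  finally show ?case using Suc by simp
qed (simp add: area_def)

lemma area_pos: "area > 0"
  using init by (simp add: area_def)

lemma length_eq: "a n + X n = area / w n"
  using area_eq[of n] positive(3)[of n] by (simp add: field_simps)

text \<open>With the area fixed, the length of the diagonal evolves independently of the other parameters.\<close>

definition "shape n = (w n)\<^sup>2 / area"

lemma shape_pos: "shape n > 0"
  using positive(3)[of n] area_pos by (simp add: shape_def)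

lemma shape_Suc: "shape (Suc n) = 1 / shape n + shape n / 4"
proof -
  have "(w (Suc n))\<^sup>2 = (area / w n)\<^sup>2 + (w n)\<^sup>2 / 4"
    by (simp add: w_Suc length_eq power_divide)
  then show ?thesis
    using positive(3)[of n] area_pos by (simp add: shape_def field_simps power2_eq_square)
qed

lemma shape_ge_1: "1 \<le> shape (Suc n)"
proof -
  have "0 \<le> (shape n / 2 - 1)\<^sup>2" by simp
  then have "shape n \<le> shape n * shape n / 4 + 1" by (simp add: power2_eq_square algebra_simps)
  then show ?thesis using shape_pos[of n] by (simp add: shape_Suc field_simps)
qed

text \<open>The positive fixed point of \<open>y \<mapsto> 1 / y + y / 4\<close>.\<close>

definition "regular_shape = 2 / sqrt (3::real)"

lemma regular_shape: "regular_shape > 0" "1 \<le> regular_shape" "1 / regular_shape + regular_shape / 4 = regular_shape"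
proof -
  have "sqrt 3 * sqrt 3 = (3::real)" by simp
  then show "1 / regular_shape + regular_shape / 4 = regular_shape"
    by (simp add: regular_shape_def field_simps)
  have "sqrt 3 \<le> (2::real)" by (rule real_le_lsqrt) auto
  then show "1 \<le> regular_shape" "regular_shape > 0" by (simp_all add: regular_shape_def)
qed

text \<open>The error is multiplied by \<open>1 / 4 - 1 / (y * regular_shape)\<close>, which lies between \<open>- 3 / 4\<close> and \<open>1 / 4\<close>
because all values of \<open>shape\<close> after the first one are at least 1.\<close>

lemma shape_contraction: "\<bar>shape (Suc (Suc n)) - regular_shape\<bar> \<le> 3 / 4 * \<bar>shape (Suc n) - regular_shape\<bar>"
proof -
  let ?y = "shape (Suc n)" and ?Y = regular_shape
  have y: "1 \<le> ?y" "1 \<le> ?Y" using shape_ge_1 regular_shape by auto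
  have "1 * 1 \<le> ?y * ?Y" using y by (intro mult_mono) auto
  then have "0 < 1 / (?y * ?Y)" "1 / (?y * ?Y) \<le> 1" by (simp_all add: divide_le_eq)
  then have c: "\<bar>1 / 4 - 1 / (?y * ?Y)\<bar> \<le> 3 / 4" unfolding abs_le_iff by linarith
  have "shape (Suc (Suc n)) - ?Y = (1 / ?y + ?y / 4) - (1 / ?Y + ?Y / 4)"
    by (simp only: shape_Suc[of "Suc n"] regular_shape(3))
  also have "\<dots> = (?y - ?Y) * (1 / 4 - 1 / (?y * ?Y))"
    using y by (simp add: field_simps)
  finally have "\<bar>shape (Suc (Suc n)) - ?Y\<bar> = \<bar>1 / 4 - 1 / (?y * ?Y)\<bar> * \<bar>?y - ?Y\<bar>"
    by (simp add: abs_mult mult.commute)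
  also have "\<dots> \<le> 3 / 4 * \<bar>?y - ?Y\<bar>" using c by (intro mult_right_mono) auto
  finally show ?thesis .
qed

lemma summable_shape_error: "summable (\<lambda>n. \<bar>shape n - regular_shape\<bar>)"
proof -
  have "\<bar>shape (Suc n) - regular_shape\<bar> \<le> \<bar>shape 1 - regular_shape\<bar> * (3 / 4) ^ n" for n
  proof (induction n)
    case (Suc n)
    then show ?case using shape_contraction[of n] by simp
  qed simp
  moreover have "summable (\<lambda>n. \<bar>shape 1 - regular_shape\<bar> * (3 / 4 :: real) ^ n)"
    by (intro summable_mult summable_geometric) simp
  ultimately have "summable (\<lambda>n. \<bar>shape (Suc n) - regular_shape\<bar>)"
    by (intro summable_comparison_test[OF _ \<open>summable (\<lambda>n. \<bar>shape 1 - regular_shape\<bar> * (3 / 4) ^ n)\<close>]) auto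
  then show ?thesis by (rule summable_Suc_iff[THEN iffD1])
qed

lemma shape_tendsto: "shape \<longlonglongrightarrow> regular_shape"
  using summable_LIMSEQ_zero[OF summable_shape_error] by (simp add: tendsto_rabs_zero_iff LIM_zero_iff)

text \<open>The circumradius \<open>R\<close> of the regular hexagon with the given area, which is \<open>3 / 2 * sqrt 3 * R^2\<close>.\<close>

definition "circumradius = sqrt (area * regular_shape / 3)"

lemma circumradius: "circumradius > 0" "area / (sqrt 3 * circumradius) = 3 / 2 * circumradius"
proof -
  show pos: "circumradius > 0" using area_pos regular_shape by (simp add: circumradius_def)
  have sq: "circumradius * circumradius = area * regular_shape / 3"
    using area_pos regular_shape(1) by (simp add: circumradius_def)
  have s3: "sqrt 3 * sqrt 3 = (3::real)" by simp
  have "sqrt 3 * circumradius * circumradius * 3 = 2 * area"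
    using sq s3 by (simp add: regular_shape_def field_simps)
  then show "area / (sqrt 3 * circumradius) = 3 / 2 * circumradius"
    using pos by (simp add: field_simps)
qed

lemma w_tendsto: "w \<longlonglongrightarrow> sqrt 3 * circumradius"
proof -
  have "w = (\<lambda>n. sqrt (area * shape n))"
    using positive(3) area_pos by (auto simp: shape_def less_imp_le)
  moreover have "(\<lambda>n. sqrt (area * shape n)) \<longlonglongrightarrow> sqrt (area * regular_shape)"
    by (intro tendsto_intros shape_tendsto)
  moreover have "sqrt (area * regular_shape) = sqrt 3 * circumradius"
    by (simp add: circumradius_def flip: real_sqrt_mult)
  ultimately show ?thesis by simp
qed

text \<open>Both the offset \<open>\<kappa>\<close> of the center and the defect \<open>X - 2 a\<close> from regular proportions are multiplied by
\<open>\<plusminus> w / (2 * w')\<close> in each step; the product of these factors telescopes, and \<open>w\<close> has a positive limit.\<close>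

lemma tendsto_0_if_halving:
  assumes "\<And>n. w (Suc n) * g (Suc n) = c * (w n * g n)" "\<bar>c\<bar> < 1"
  shows "g \<longlonglongrightarrow> 0"
proof -
  have "w n * g n = c ^ n * (w 0 * g 0)" for n
    by (induction n) (simp_all add: assms(1))
  then have "(\<lambda>n. w n * g n) = (\<lambda>n. c ^ n * (w 0 * g 0))" by (rule ext)
  moreover have "(\<lambda>n. c ^ n * (w 0 * g 0)) \<longlonglongrightarrow> 0"
    using assms(2) by (intro tendsto_mult_left_zero LIMSEQ_power_zero) simp
  ultimately have "(\<lambda>n. w n * g n) \<longlonglongrightarrow> 0" by (simp only:)
  then have "(\<lambda>n. w n * g n / w n) \<longlonglongrightarrow> 0 / (sqrt 3 * circumradius)"
    using circumradius(1) by (intro tendsto_divide w_tendsto) auto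
  moreover have "w n * g n / w n = g n" for n using positive(3)[of n] by simp
  ultimately show ?thesis by simp
qed

lemma \<kappa>_tendsto: "\<kappa> \<longlonglongrightarrow> 0"
proof (rule tendsto_0_if_halving[of _ "1 / 2"])
  show "w (Suc n) * \<kappa> (Suc n) = 1 / 2 * (w n * \<kappa> n)" for n
    using positive(3)[of "Suc n"] by (simp add: \<kappa>_Suc)
qed simp

lemma defect_tendsto: "(\<lambda>n. X n - 2 * a n) \<longlonglongrightarrow> 0"
proof (rule tendsto_0_if_halving[of _ "- 1 / 2"])
  show "w (Suc n) * (X (Suc n) - 2 * a (Suc n)) = - 1 / 2 * (w n * (X n - 2 * a n))" for n
    using positive(3)[of "Suc n"] by (simp add: X_Suc a_Suc right_diff_distrib) (simp add: field_simps)
qed simp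

lemma length_tendsto: "(\<lambda>n. a n + X n) \<longlonglongrightarrow> 3 / 2 * circumradius"
proof -
  have "(\<lambda>n. area / w n) \<longlonglongrightarrow> area / (sqrt 3 * circumradius)"
    using circumradius(1) by (intro tendsto_intros w_tendsto) auto
  then show ?thesis by (simp add: length_eq circumradius(2))
qed

lemma X_tendsto: "X \<longlonglongrightarrow> circumradius"
proof -
  have "(\<lambda>n. (2 * (a n + X n) + (X n - 2 * a n)) / 3) \<longlonglongrightarrow> (2 * (3 / 2 * circumradius) + 0) / 3"
    by (intro tendsto_intros length_tendsto defect_tendsto) simp
  then show ?thesis by simp
qed

lemma a_tendsto: "a \<longlonglongrightarrow> circumradius / 2"
proof -
  have "(\<lambda>n. ((a n + X n) - (X n - 2 * a n)) / 3) \<longlonglongrightarrow> (3 / 2 * circumradius - 0) / 3"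
    by (intro tendsto_intros length_tendsto defect_tendsto) simp
  then show ?thesis by simp
qed

text \<open>A regular hexagon would turn by exactly \<open>pi / 3\<close>. Since \<open>arctan\<close> is Lipschitz, the deviations are
dominated by the summable errors of the shape.\<close>

lemma angle_tendsto: "\<exists>\<phi>. (\<lambda>n. \<theta> n + real n * (pi / 3)) \<longlonglongrightarrow> \<phi>"
proof -
  define \<phi> where "\<phi> n = \<theta> n + real n * (pi / 3)" for n
  have "arctan (regular_shape / 2) = pi / 6"
    by (rule arctan_unique) (simp_all add: regular_shape_def tan_30)
  moreover have "w n / (2 * (a n + X n)) = shape n / 2" for n
    unfolding length_eq shape_def power2_eq_square using positive(3)[of n] area_pos by simp
  moreover have "\<phi> (Suc n) - \<phi> n = arctan (w n / (2 * (a n + X n))) - pi / 6" for n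
    unfolding \<phi>_def \<theta>_Suc by (simp only: of_nat_Suc distrib_right)
  ultimately have step: "\<phi> (Suc n) - \<phi> n = arctan (shape n / 2) - arctan (regular_shape / 2)" for n
    by (simp only:)
  have "\<bar>\<phi> (Suc n) - \<phi> n\<bar> \<le> \<bar>shape n - regular_shape\<bar>" for n
    unfolding step using abs_arctan_diff_le[of "shape n / 2" "regular_shape / 2"] by linarith
  then have "summable (\<lambda>n. \<phi> (Suc n) - \<phi> n)"
    by (intro summable_comparison_test[OF _ summable_shape_error]) auto
  then have "(\<lambda>m. \<Sum>n<m. \<phi> (Suc n) - \<phi> n) \<longlonglongrightarrow> (\<Sum>n. \<phi> (Suc n) - \<phi> n)"
    by (rule summable_LIMSEQ)
  then have "(\<lambda>m. (\<phi> m - \<phi> 0) + \<phi> 0) \<longlonglongrightarrow> (\<Sum>n. \<phi> (Suc n) - \<phi> n) + \<phi> 0"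
    unfolding sum_lessThan_telescope by (intro tendsto_intros)
  then show ?thesis by (auto simp: \<phi>_def)
qed

end

section \<open>Convergence in Hausdorff distance\<close>

text \<open>The points within \<open>\<epsilon>\<close> of a convex set form a convex set.\<close>

lemma convex_hull_points_close:
  fixes V W :: "'i \<Rightarrow> 'a::real_normed_vector"
  assumes close: "\<And>i. i \<in> I \<Longrightarrow> dist (V i) (W i) \<le> \<epsilon>" and x: "x \<in> convex hull (V ` I)"
  shows "\<exists>y\<in>convex hull (W ` I). dist x y \<le> \<epsilon>"
proof -
  let ?C = "{x. \<exists>y\<in>convex hull (W ` I). dist x y \<le> \<epsilon>}"
  have "convex ?C"
  proof (rule convexI)
    fix x x' and u v :: real
    assume h: "x \<in> ?C" "x' \<in> ?C" "0 \<le> u" "0 \<le> v" "u + v = 1"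
    then obtain y y' where y: "y \<in> convex hull (W ` I)" "dist x y \<le> \<epsilon>" "y' \<in> convex hull (W ` I)" "dist x' y' \<le> \<epsilon>"
      by auto
    have "dist (u *\<^sub>R x + v *\<^sub>R x') (u *\<^sub>R y + v *\<^sub>R y') = norm (u *\<^sub>R (x - y) + v *\<^sub>R (x' - y'))"
      by (simp add: dist_norm algebra_simps)
    also have "\<dots> \<le> u * norm (x - y) + v * norm (x' - y')"
      using norm_triangle_ineq[of "u *\<^sub>R (x - y)" "v *\<^sub>R (x' - y')"] h by simp
    also have "\<dots> \<le> u * \<epsilon> + v * \<epsilon>"
      using h y by (intro add_mono mult_left_mono) (auto simp: dist_norm)
    also have "\<dots> = \<epsilon>" using h by (simp flip: distrib_right)
    finally show "u *\<^sub>R x + v *\<^sub>R x' \<in> ?C"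
      using convexD[OF convex_convex_hull y(1,3) h(3-5)] by blast
  qed
  moreover have "V ` I \<subseteq> ?C" using close by (auto intro: hull_inc)
  ultimately have "convex hull (V ` I) \<subseteq> ?C" by (intro hull_minimal)
  then show ?thesis using x by auto
qed

lemma hausdorff_distance_bounds:
  assumes ne: "A \<noteq> {}" "B \<noteq> {}"
    and AB: "\<And>x. x \<in> A \<Longrightarrow> \<exists>y\<in>B. dist x y \<le> \<epsilon>" and BA: "\<And>y. y \<in> B \<Longrightarrow> \<exists>x\<in>A. dist y x \<le> \<epsilon>"
  shows "0 \<le> hausdorff_distance A B" "hausdorff_distance A B \<le> \<epsilon>"
proof -
  have 1: "infdist x B \<le> \<epsilon>" if "x \<in> A" for x
    using AB[OF that] infdist_le order_trans by metis
  have 2: "infdist y A \<le> \<epsilon>" if "y \<in> B" for y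
    using BA[OF that] infdist_le order_trans by metis
  have "(SUP x\<in>A. infdist x B) \<le> \<epsilon>" "(SUP y\<in>B. infdist y A) \<le> \<epsilon>"
    using ne 1 2 by (auto intro!: cSUP_least)
  then show "hausdorff_distance A B \<le> \<epsilon>" by (simp add: hausdorff_distance_def)
  obtain x where x: "x \<in> A" using ne by auto
  have "0 \<le> infdist x B" by (rule infdist_nonneg)
  also have "\<dots> \<le> (SUP x\<in>A. infdist x B)"
    using 1 x by (intro cSUP_upper bdd_aboveI2)
  finally show "0 \<le> hausdorff_distance A B" by (simp add: hausdorff_distance_def)
qed

text \<open>The vertices of an axial hexagon in cyclic order, starting from the one on the axis, so that vertex
\<open>k\<close> of a regular hexagon is in direction \<open>\<theta> + k * pi / 3\<close>.\<close>

definition hexagon_vertex :: "real \<Rightarrow> real \<Rightarrow> real \<Rightarrow> real \<Rightarrow> real \<Rightarrow> nat \<Rightarrow> real^2" where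
  "hexagon_vertex \<theta> \<kappa> X a w k = (\<kappa> + [X, a, - a, - X, - a, a] ! k) *\<^sub>R axis_dir \<theta> +
    ([0, w, w, 0, - w, - w] ! k / 2) *\<^sub>R normal_dir \<theta>"

lemma lessThan_6: "{..<6::nat} = {0, 1, 2, 3, 4, 5}"
  by auto

lemma axial_hexagon_eq_hull:
  assumes aX: "0 < a" "a < X" and w: "0 < w"
  shows "axial_hexagon \<theta> \<kappa> X a w = convex hull (hexagon_vertex \<theta> \<kappa> X a w ` {..<6})"
proof -
  let ?u = "axis_dir \<theta>" and ?v = "normal_dir \<theta>"
  define w' where "w' = sqrt ((a + X)\<^sup>2 + (w / 2)\<^sup>2)"
  define \<phi> where "\<phi> = arctan (w / (2 * (a + X)))"
  note frame = diagonal_frame[OF aX w, folded w'_def \<phi>_def]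
  have sum: "(a *\<^sub>R ?u + (w / 2) *\<^sub>R ?v) + X *\<^sub>R ?u = w' *\<^sub>R normal_dir (\<theta> + \<phi> - pi / 2)"
    unfolding dir_rotate scaleR_add_right scaleR_scaleR frame by (simp add: algebra_simps)
  have "hexagon_vertex \<theta> \<kappa> X a w ` {..<6} =
    {\<kappa> *\<^sub>R ?u + (- a *\<^sub>R ?u + (w / 2) *\<^sub>R ?v), \<kappa> *\<^sub>R ?u - (- a *\<^sub>R ?u + (w / 2) *\<^sub>R ?v),
     \<kappa> *\<^sub>R ?u + (a *\<^sub>R ?u + (w / 2) *\<^sub>R ?v), \<kappa> *\<^sub>R ?u - (a *\<^sub>R ?u + (w / 2) *\<^sub>R ?v),
     \<kappa> *\<^sub>R ?u + X *\<^sub>R ?u, \<kappa> *\<^sub>R ?u - X *\<^sub>R ?u}"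
    unfolding lessThan_6 image_insert image_empty
    by (simp add: hexagon_vertex_def algebra_simps insert_commute)
  then show ?thesis
    using hexagonal_eq_hull[OF hexagonal_axial_hexagon[OF aX w] sum frame(1), of \<kappa>] by simp
qed

lemma regular_hexagon_vertex:
  assumes "k < 6"
  shows "hexagon_vertex \<theta> 0 R (R / 2) (sqrt 3 * R) k = R *\<^sub>R axis_dir (\<theta> + real k * pi / 3)"
proof -
  have dir: "axis_dir (\<theta> + t) = cos t *\<^sub>R axis_dir \<theta> + sin t *\<^sub>R normal_dir \<theta>" for t
    by (simp add: vec_eq_iff forall_2 cos_add sin_add)
  have cs: "cos (2 * pi / 3) = - 1 / 2" "sin (2 * pi / 3) = sqrt 3 / 2"
    "cos (4 * pi / 3) = - 1 / 2" "sin (4 * pi / 3) = - sqrt 3 / 2"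
    "cos (5 * pi / 3) = 1 / 2" "sin (5 * pi / 3) = - sqrt 3 / 2"
  proof -
    have eq: "2 * pi / 3 = pi - pi / 3" "4 * pi / 3 = pi / 3 + pi" "5 * pi / 3 = 2 * pi - pi / 3" by simp_all
    show "cos (2 * pi / 3) = - 1 / 2" "sin (2 * pi / 3) = sqrt 3 / 2"
      unfolding eq(1) cos_diff sin_diff by (simp_all add: cos_60 sin_60)
    show "cos (4 * pi / 3) = - 1 / 2" "sin (4 * pi / 3) = - sqrt 3 / 2"
      unfolding eq(2) cos_add sin_add by (simp_all add: cos_60 sin_60)
    show "cos (5 * pi / 3) = 1 / 2" "sin (5 * pi / 3) = - sqrt 3 / 2"
      unfolding eq(3) cos_diff sin_diff by (simp_all add: cos_60 sin_60)
  qed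
  note cs' = cs[unfolded mult.commute[of _ pi]]
  have "k \<in> {0, 1, 2, 3, 4, 5}" using assms by auto
  then show ?thesis
    by (elim insertE emptyE) (simp_all add: hexagon_vertex_def dir cs cs' cos_60 sin_60 scaleR_add_right scaleR_diff_right mult.commute)
qed

lemma regular_vertices_shift:
  "(\<lambda>k. R *\<^sub>R axis_dir (\<theta> + real n * (pi / 3) + real k * pi / 3)) ` {..<6} =
   (\<lambda>k. R *\<^sub>R axis_dir (\<theta> + real k * pi / 3)) ` {..<6}"
proof (induction n)
  case (Suc n)
  define f where "f k = R *\<^sub>R axis_dir (\<theta> + real n * (pi / 3) + real k * pi / 3)" for k
  have Suc_eq: "(\<lambda>k. R *\<^sub>R axis_dir (\<theta> + real (Suc n) * (pi / 3) + real k * pi / 3)) = f \<circ> Suc"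
    by (simp add: fun_eq_iff f_def add_divide_distrib algebra_simps)
  have "f 6 = f 0"
  proof -
    have "f 6 = R *\<^sub>R axis_dir ((\<theta> + real n * (pi / 3)) + 2 * pi)" by (simp add: f_def)
    also have "\<dots> = f 0" by (simp add: f_def axis_dir_def sin_add cos_add)
    finally show ?thesis .
  qed
  then have "f ` Suc ` {..<6} = f ` {..<6}" unfolding lessThan_6 by (auto simp: numeral_eq_Suc)
  also have "\<dots> = (\<lambda>k. R *\<^sub>R axis_dir (\<theta> + real k * pi / 3)) ` {..<6}"
    unfolding f_def by (rule Suc)
  finally show ?case unfolding Suc_eq image_comp .
qed simp

lemma dist_hexagon_vertex_le:
  assumes "k < 6"
  shows "dist (hexagon_vertex \<theta> \<kappa> X a w k) (hexagon_vertex \<theta> \<kappa>' X' a' w' k)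
    \<le> \<bar>\<kappa> - \<kappa>'\<bar> + \<bar>X - X'\<bar> + \<bar>a - a'\<bar> + \<bar>w - w'\<bar>"
proof -
  let ?s = "[X, a, - a, - X, - a, a] ! k" and ?s' = "[X', a', - a', - X', - a', a'] ! k"
  let ?t = "[0, w, w, 0, - w, - w] ! k / 2" and ?t' = "[0, w', w', 0, - w', - w'] ! k / 2"
  have "dist (hexagon_vertex \<theta> \<kappa> X a w k) (hexagon_vertex \<theta> \<kappa>' X' a' w' k) =
    norm ((\<kappa> + ?s - (\<kappa>' + ?s')) *\<^sub>R axis_dir \<theta> + (?t - ?t') *\<^sub>R normal_dir \<theta>)"
    by (simp add: dist_norm hexagon_vertex_def algebra_simps)
  also have "\<dots> \<le> \<bar>\<kappa> + ?s - (\<kappa>' + ?s')\<bar> + \<bar>?t - ?t'\<bar>"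
    by (rule order_trans[OF norm_triangle_ineq]) simp
  also have "\<dots> \<le> \<bar>\<kappa> - \<kappa>'\<bar> + \<bar>?s - ?s'\<bar> + \<bar>?t - ?t'\<bar>" by linarith
  finally have "dist (hexagon_vertex \<theta> \<kappa> X a w k) (hexagon_vertex \<theta> \<kappa>' X' a' w' k) \<le> \<dots>" .
  moreover have "\<bar>?s - ?s'\<bar> \<le> \<bar>X - X'\<bar> + \<bar>a - a'\<bar> \<and> \<bar>?t - ?t'\<bar> \<le> \<bar>w - w'\<bar>"
  proof -
    have "k \<in> {0, 1, 2, 3, 4, 5}" using assms by auto
    then show ?thesis by (elim insertE emptyE) auto
  qed
  ultimately show ?thesis by linarith
qed

lemma tendsto_axis_dir [tendsto_intros]:
  fixes f :: "nat \<Rightarrow> real"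
  assumes "(f \<longlongrightarrow> l) F" shows "((\<lambda>x. axis_dir (f x)) \<longlongrightarrow> axis_dir l) F"
proof (rule vec_tendstoI)
  fix i :: 2
  show "((\<lambda>x. axis_dir (f x) $ i) \<longlongrightarrow> axis_dir l $ i) F"
    using exhaust_2[of i] by (elim disjE) (simp_all add: tendsto_cos[OF assms] tendsto_sin[OF assms])
qed

context hexagon_orbit
begin

text \<open>The hexagon is close to the regular hexagon with the same axis, whose vertices are also those with axis
\<open>\<theta> n + n * pi / 3\<close>, and these directions converge.\<close>

theorem orbit_tendsto_regular_hexagon:
  "\<exists>K. regular_hexagon K \<and>
    (\<lambda>n. hausdorff_distance (axial_hexagon (\<theta> n) (\<kappa> n) (X n) (a n) (w n)) K) \<longlonglongrightarrow> 0"
proof -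
  obtain \<phi> where \<phi>: "(\<lambda>n. \<theta> n + real n * (pi / 3)) \<longlonglongrightarrow> \<phi>" using angle_tendsto by blast
  let ?R = circumradius
  define V where "V n = hexagon_vertex (\<theta> n) (\<kappa> n) (X n) (a n) (w n)" for n
  define U where "U t k = ?R *\<^sub>R axis_dir (t + real k * pi / 3)" for t and k :: nat
  define K where "K = convex hull (U \<phi> ` {..<6})"
  have "regular_hexagon K"
    unfolding regular_hexagon_def
    by (intro exI[of _ 0] exI[of _ ?R] exI[of _ \<phi>]) (simp add: circumradius(1) K_def U_def axis_dir_def)
  have hull: "axial_hexagon (\<theta> n) (\<kappa> n) (X n) (a n) (w n) = convex hull (V n ` {..<6})" for n
    unfolding V_def by (rule axial_hexagon_eq_hull[OF positive])
  have shift: "U (\<theta> n + real n * (pi / 3)) ` {..<6} = U (\<theta> n) ` {..<6}" for n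
    unfolding U_def by (rule regular_vertices_shift)
  define \<epsilon> where "\<epsilon> n = \<bar>\<kappa> n - 0\<bar> + \<bar>X n - ?R\<bar> + \<bar>a n - ?R / 2\<bar> + \<bar>w n - sqrt 3 * ?R\<bar>" for n
  define \<delta> where "\<delta> n = (\<Sum>k<6. dist (U (\<theta> n + real n * (pi / 3)) k) (U \<phi> k))" for n
  have VU: "dist (V n k) (U (\<theta> n) k) \<le> \<epsilon> n" if "k \<in> {..<6}" for n k
    using dist_hexagon_vertex_le[of k "\<theta> n" "\<kappa> n" "X n" "a n" "w n" 0 ?R "?R / 2" "sqrt 3 * ?R"] that
    by (simp add: V_def U_def \<epsilon>_def regular_hexagon_vertex)
  have UU: "dist (U (\<theta> n + real n * (pi / 3)) k) (U \<phi> k) \<le> \<delta> n" if "k \<in> {..<6}" for n k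
    unfolding \<delta>_def using that by (intro member_le_sum) auto
  have there: "\<exists>y\<in>K. dist x y \<le> \<epsilon> n + \<delta> n" if x: "x \<in> convex hull (V n ` {..<6})" for x n
  proof -
    obtain x' where x': "x' \<in> convex hull (U (\<theta> n) ` {..<6})" "dist x x' \<le> \<epsilon> n"
      using convex_hull_points_close[OF VU x] by blast
    then have "x' \<in> convex hull (U (\<theta> n + real n * (pi / 3)) ` {..<6})" by (simp only: shift)
    from convex_hull_points_close[OF UU this]
    obtain y where "y \<in> K" "dist x' y \<le> \<delta> n" unfolding K_def by blast
    then show ?thesis using x'(2) dist_triangle[of x y x'] by (intro bexI[of _ y]) auto
  qed
  have conversely: "\<exists>y\<in>convex hull (V n ` {..<6}). dist x y \<le> \<epsilon> n + \<delta> n" if x: "x \<in> K" for x n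
  proof -
    obtain x' where x': "x' \<in> convex hull (U (\<theta> n + real n * (pi / 3)) ` {..<6})" "dist x x' \<le> \<delta> n"
      using convex_hull_points_close[of "{..<6}" "U \<phi>" "U (\<theta> n + real n * (pi / 3))" "\<delta> n" x] UU x
      unfolding K_def by (auto simp: dist_commute)
    then have "x' \<in> convex hull (U (\<theta> n) ` {..<6})" by (simp only: shift)
    then obtain y where "y \<in> convex hull (V n ` {..<6})" "dist x' y \<le> \<epsilon> n"
      using convex_hull_points_close[of "{..<6}" "U (\<theta> n)" "V n" "\<epsilon> n" x'] VU by (auto simp: dist_commute)
    then show ?thesis using x'(2) dist_triangle[of x y x'] by (intro bexI[of _ y]) auto
  qed
  have ne: "convex hull (V n ` {..<6}) \<noteq> {}" "K \<noteq> {}" for n by (auto simp: K_def lessThan_6)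
  note bounds = hausdorff_distance_bounds[OF ne there conversely]
  have "\<epsilon> \<longlonglongrightarrow> \<bar>0 - 0\<bar> + \<bar>?R - ?R\<bar> + \<bar>?R / 2 - ?R / 2\<bar> + \<bar>sqrt 3 * ?R - sqrt 3 * ?R\<bar>"
    unfolding \<epsilon>_def by (intro tendsto_intros \<kappa>_tendsto X_tendsto a_tendsto w_tendsto)
  moreover have "\<delta> \<longlonglongrightarrow> (\<Sum>k<6. dist (U \<phi> k) (U \<phi> k))"
    unfolding \<delta>_def U_def by (intro tendsto_intros \<phi>)
  ultimately have "(\<lambda>n. \<epsilon> n + \<delta> n) \<longlonglongrightarrow> 0 + 0" by (intro tendsto_add) simp_all
  then have lim: "(\<lambda>n. \<epsilon> n + \<delta> n) \<longlonglongrightarrow> 0" by simp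
  have "(\<lambda>n. hausdorff_distance (convex hull (V n ` {..<6})) K) \<longlonglongrightarrow> 0"
    by (rule real_tendsto_sandwich[OF always_eventually always_eventually tendsto_const lim]) (use bounds in blast)+
  then show ?thesis using \<open>regular_hexagon K\<close> by (auto simp: hull)
qed

end

lemma hexagon_orbit_ex:
  assumes "0 < a0" "a0 < X0" "0 < w0"
  obtains \<theta> \<kappa> X a w where "hexagon_orbit \<theta> \<kappa> X a w"
    "\<theta> 0 = \<theta>0" "\<kappa> 0 = \<kappa>0" "X 0 = X0" "a 0 = a0" "w 0 = w0"
proof -
  define step where "step = (\<lambda>(\<theta> :: real, \<kappa> :: real, X :: real, a :: real, w :: real).
    let w' = sqrt ((a + X)\<^sup>2 + (w / 2)\<^sup>2) in
      (\<theta> + arctan (w / (2 * (a + X))) - pi / 2, \<kappa> * w / (2 * w'), w * (2 * a + X) / (2 * w'), w * X / (2 * w'), w'))"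
  define st where "st n = (step ^^ n) (\<theta>0, \<kappa>0, X0, a0, w0)" for n
  define \<theta> where "\<theta> n = fst (st n)" for n
  define \<kappa> where "\<kappa> n = fst (snd (st n))" for n
  define X where "X n = fst (snd (snd (st n)))" for n
  define a where "a n = fst (snd (snd (snd (st n))))" for n
  define w where "w n = snd (snd (snd (snd (st n))))" for n
  note defs = \<theta>_def \<kappa>_def X_def a_def w_def
  have st: "st n = (\<theta> n, \<kappa> n, X n, a n, w n)" for n by (simp add: defs)
  have "st (Suc n) = step (st n)" for n by (simp add: st_def)
  then have Suc: "st (Suc n) = step (\<theta> n, \<kappa> n, X n, a n, w n)" for n using st by simp
  have 0: "\<theta> 0 = \<theta>0" "\<kappa> 0 = \<kappa>0" "X 0 = X0" "a 0 = a0" "w 0 = w0"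
    by (simp_all add: defs st_def)
  have "hexagon_orbit \<theta> \<kappa> X a w"
    using assms Suc 0 by unfold_locales (simp_all add: st step_def Let_def)
  then show thesis using 0 by (rule that)
qed

lemma normal_dir_ex:
  assumes "z \<noteq> 0" obtains \<theta> where "z = norm z *\<^sub>R normal_dir \<theta>"
proof -
  have n: "norm z > 0" using assms by simp
  have "(norm z)\<^sup>2 = (z $ 1)\<^sup>2 + (z $ 2)\<^sup>2"
    unfolding power2_norm_eq_inner by (simp add: inner_real2 power2_eq_square)
  moreover have "(z $ 2 / norm z)\<^sup>2 + (- (z $ 1) / norm z)\<^sup>2 = ((z $ 1)\<^sup>2 + (z $ 2)\<^sup>2) / (norm z)\<^sup>2"
    by (simp add: power_divide add_divide_distrib)
  ultimately have "(z $ 2 / norm z)\<^sup>2 + (- (z $ 1) / norm z)\<^sup>2 = (norm z)\<^sup>2 / (norm z)\<^sup>2"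
    by (simp only:)
  also have "\<dots> = 1" using n by simp
  finally obtain \<theta> where \<theta>: "z $ 2 / norm z = cos \<theta>" "- (z $ 1) / norm z = sin \<theta>"
    by (rule sincos_total_2pi)
  have "norm z * (z $ 2 / norm z) = z $ 2" "norm z * (- (z $ 1) / norm z) = - (z $ 1)" using n by simp_all
  then have "z = norm z *\<^sub>R normal_dir \<theta>"
    unfolding \<theta> by (simp add: vec_eq_iff forall_2)
  then show thesis by (rule that)
qed

theorem lemma2p1:
  fixes H\<^sub>0 :: "(real^2) set"
  assumes "H\<^sub>0 \<in> tessellating_polygons"
  shows
    "(\<exists>(N::nat) (L :: nat \<Rightarrow> (real^2) set) (H :: nat \<Rightarrow> (real^2) set).
        H 0 = H\<^sub>0 \<and>
        (\<forall>n<N. line_through_origin (L n) \<and> H (Suc n) = steiner_symmetrization (L n) (H n)) \<and>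
        regular_hexagon (H N))
     \<or>
     (\<exists>(L :: nat \<Rightarrow> (real^2) set) (H :: nat \<Rightarrow> (real^2) set) (K :: (real^2) set).
        H 0 = H\<^sub>0 \<and>
        (\<forall>n. line_through_origin (L n) \<and> H (Suc n) = steiner_symmetrization (L n) (H n)) \<and>
        regular_hexagon K \<and>
        (\<lambda>n. hausdorff_distance (H n) K) \<longlonglongrightarrow> 0)"
proof (rule disjI2)
  obtain c p q r where hex: "hexagonal H\<^sub>0 c p q r"
    using hexagonal_if_tessellating[OF assms] by blast
  have "q + r \<noteq> 0"
  proof
    assume "q + r = 0"
    obtain \<beta> where "\<beta> \<bullet> q = 1" "\<beta> \<bullet> r = (1::real)" using hex unfolding hexagonal_def by blast
    then have "\<beta> \<bullet> (q + r) = 2" by (simp add: inner_add_right)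
    then show False using \<open>q + r = 0\<close> by simp
  qed
  then obtain \<theta>0 where \<theta>0: "q + r = norm (q + r) *\<^sub>R normal_dir \<theta>0" and w0: "norm (q + r) > 0"
    using normal_dir_ex[of "q + r"] by auto
  define X0 where "X0 = \<bar>axis_dir \<theta>0 \<bullet> p\<bar>"
  define a0 where "a0 = \<bar>axis_dir \<theta>0 \<bullet> r\<bar>"
  have aX: "0 < a0" "a0 < X0"
    using hexagon_sections(1,2)[OF hex \<theta>0 w0] by (simp_all add: X0_def a0_def)
  obtain \<theta> \<kappa> X a w where orbit: "hexagon_orbit \<theta> \<kappa> X a w" and
    0: "\<theta> 0 = \<theta>0" "\<kappa> 0 = axis_dir \<theta>0 \<bullet> c" "X 0 = X0" "a 0 = a0" "w 0 = norm (q + r)"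
    by (rule hexagon_orbit_ex[OF aX w0])
  interpret hexagon_orbit \<theta> \<kappa> X a w by (rule orbit)
  \<comment> \<open>The first symmetrization produces the axial hexagon with index 0, so \<open>G\<close> lags behind \<open>H\<close> by one step.\<close>
  define G where "G n = axial_hexagon (\<theta> n) (\<kappa> n) (X n) (a n) (w n)" for n
  define H where "H n = (case n of 0 \<Rightarrow> H\<^sub>0 | Suc m \<Rightarrow> G m)" for n
  define L where "L n = {x. normal_dir (\<theta> n) \<bullet> x = 0}" for n
  obtain K where K: "regular_hexagon K" "(\<lambda>n. hausdorff_distance (G n) K) \<longlonglongrightarrow> 0"
    using orbit_tendsto_regular_hexagon unfolding G_def by blast
  have line: "line_through_origin (L n)" for n
  proof -
    have "normal_dir (\<theta> n) \<noteq> 0" using norm_dir(2)[of "\<theta> n"] by (metis norm_zero zero_neq_one)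
    then show ?thesis unfolding L_def by (rule line_through_origin_hyperplane)
  qed
  have first: "G 0 = steiner_symmetrization (L 0) H\<^sub>0"
    using steiner_symmetrization_hexagonal[OF hex \<theta>0 w0] by (simp add: G_def L_def 0 X0_def a0_def)
  have rest: "G (Suc m) = steiner_symmetrization (L (Suc m)) (G m)" for m
    using steiner_symmetrization_axial_hexagon[OF positive(1)[of m] positive(2)[of m] positive(3)[of m],
        where \<theta> = "\<theta> m" and \<kappa> = "\<kappa> m"]
    by (simp only: G_def L_def \<theta>_Suc \<kappa>_Suc X_Suc a_Suc w_Suc)
  have "H (Suc n) = steiner_symmetrization (L n) (H n)" for n
    using first rest by (cases n) (simp_all add: H_def)
  moreover have "(\<lambda>n. hausdorff_distance (H n) K) \<longlonglongrightarrow> 0"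
    by (rule LIMSEQ_imp_Suc) (simp add: H_def K(2))
  moreover have "H 0 = H\<^sub>0" by (simp add: H_def)
  ultimately show "\<exists>(L :: nat \<Rightarrow> (real^2) set) (H :: nat \<Rightarrow> (real^2) set) (K :: (real^2) set).
        H 0 = H\<^sub>0 \<and>
        (\<forall>n. line_through_origin (L n) \<and> H (Suc n) = steiner_symmetrization (L n) (H n)) \<and>
        regular_hexagon K \<and>
        (\<lambda>n. hausdorff_distance (H n) K) \<longlonglongrightarrow> 0"
    using line K(1) by (intro exI[of _ L] exI[of _ H] exI[of _ K]) simp
qed

end
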